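(* Let $C=(C,S,\gamma)$ be a coseparable copivotal coalgebra over $k$ with coseparability idempotent $\lambda:C\times C\to k$. Then, for all finite-dimensional right $C$-comodules $V$, $$\nu(V)=\lambda\big(S(\gamma\rightharpoonup t_{V(1)}),\,t_{V(2)}\big)\quad\Big(=\lambda\big(S(t_{V(1)}),t_{V(3)}\big)\,\gamma(t_{V(2)})\Big),$$ where $t_V\in C$ is the character of $V$.
   Context: $k$ is a field of characteristic not two; coalgebras are over $k$, with Sweedler notation $\Delta(c)=c_{(1)}\otimes c_{(2)}$; a right comodule coaction is written $v\mapsto v_{(0)}\otimes v_{(1)}$. A copivotal coalgebra is a triple $(C,S,\gamma)$ of a coalgebra $C$, an anti-coalgebra map $S:C\to C$ and a linear map $\gamma:C\to k$ with convolution inverse $\overline{\gamma}$ such that $\overline{\gamma}=\gamma\circ S$ and $S^2(c)=\gamma(c_{(1)})\,c_{(2)}\,\overline{\gamma}(c_{(3)})$ for all $c\in C$. For $\lambda'\in C^\vee=\mathrm{Hom}_k(C,k)$ and $v$ in a right $C$-comodule put $\lambda'\rightharpoonup v=v_{(0)}\lambda'(v_{(1)})$; in particular $\gamma\rightharpoonup c=c_{(1)}\gamma(c_{(2)})$ for $c\in C$. For a finite-dimensional right $C$-comodule $V$, the dual space $V^\vee$ is a right $C$-comodule by $\langle f_{(0)},v\rangle f_{(1)}=\langle f,v_{(0)}\rangle S(v_{(1)})$, and $j_V:V\to V^{\vee\vee}$, $\langle j_V(v),f\rangle=\langle f,\gamma\rightharpoonup v\rangle$, is a comodule isomorphism. The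 Frobenius--Schur indicator $\nu(V)\in k$ is the trace of the linear map $\mathrm{Hom}_C(V,V^\vee)\to\mathrm{Hom}_C(V,V^\vee)$, $f\mapsto f^\vee\circ j_V$, where $f^\vee$ is the transpose of $f$ and $\mathrm{Hom}_C$ denotes $C$-comodule maps. If $\{v_i\}$ is a basis of $V$ and the coaction is $v_j\mapsto\sum_iv_i\otimes c_{ij}$, the character of $V$ is $t_V=\sum_ic_{ii}\in C$. A coseparability idempotent of $C$ is a bilinear form $\lambda:C\times C\to k$ such that $c_{(1)}\lambda(c_{(2)},d)=\lambda(c,d_{(1)})d_{(2)}$ and $\lambda(c_{(1)},c_{(2)})=\varepsilon(c)$ for all $c,d\in C$; $C$ is coseparable if one exists. *)

theory Defs
  imports Complex_Main "HOL-Library.Function_Algebras"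
begin

section \<open>Tensor products of vector spaces\<close>

text \<open>
  Vector spaces are given by a scalar multiplication \<open>s\<close> with \<open>vector_space s\<close>; function
  spaces carry the pointwise structure.
\<close>

definition fun_scale :: "('k \<Rightarrow> 'u \<Rightarrow> 'u) \<Rightarrow> 'k \<Rightarrow> ('x \<Rightarrow> 'u) \<Rightarrow> 'x \<Rightarrow> 'u" where
  "fun_scale s a f = (\<lambda>x. s a (f x))"

definition bilinear_map ::
  "('k::field \<Rightarrow> 'v::ab_group_add \<Rightarrow> 'v) \<Rightarrow> ('k \<Rightarrow> 'w::ab_group_add \<Rightarrow> 'w) \<Rightarrow>
   ('k \<Rightarrow> 'u::ab_group_add \<Rightarrow> 'u) \<Rightarrow> ('v \<Rightarrow> 'w \<Rightarrow> 'u) \<Rightarrow> bool" where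
  "bilinear_map sV sW sU b \<longleftrightarrow>
     (\<forall>v. Vector_Spaces.linear sW sU (b v)) \<and> (\<forall>w. Vector_Spaces.linear sV sU (\<lambda>v. b v w))"

text \<open>
  Over a field, \<open>V \<otimes> W\<close> embeds into the dual of the space of bilinear forms on \<open>V \<times> W\<close>, the
  pure tensor \<open>v \<otimes> w\<close> being evaluation at \<open>(v, w)\<close>. The tensor product is modelled as the span of
  these evaluations; the universal property is proved below. For subspaces \<open>A\<close> and \<open>B\<close> the
  subspace \<open>tensor_space sV sW A B\<close> of \<open>V \<otimes> W\<close> is \<open>A \<otimes> B\<close>, since over a field
  \<open>A \<otimes> B \<rightarrow> V \<otimes> W\<close> is injective.
\<close>

definition tensor ::
  "('k::field \<Rightarrow> 'v::ab_group_add \<Rightarrow> 'v) \<Rightarrow> ('k \<Rightarrow> 'w::ab_group_add \<Rightarrow> 'w) \<Rightarrow>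
   'v \<Rightarrow> 'w \<Rightarrow> ('v \<Rightarrow> 'w \<Rightarrow> 'k) \<Rightarrow> 'k" where
  "tensor sV sW v w = (\<lambda>b. if bilinear_map sV sW (*) b then b v w else 0)"

definition tensor_space ::
  "('k::field \<Rightarrow> 'v::ab_group_add \<Rightarrow> 'v) \<Rightarrow> ('k \<Rightarrow> 'w::ab_group_add \<Rightarrow> 'w) \<Rightarrow>
   'v set \<Rightarrow> 'w set \<Rightarrow> (('v \<Rightarrow> 'w \<Rightarrow> 'k) \<Rightarrow> 'k) set" where
  "tensor_space sV sW A B = module.span (fun_scale (*)) {tensor sV sW v w |v w. v \<in> A \<and> w \<in> B}"

text \<open>
  The map \<open>V \<otimes> W \<rightarrow> U\<close> induced by a bilinear map \<open>b\<close>, computed on a chosen expression of a tensor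
  as a sum of pure tensors. It renders Sweedler notation: if \<open>\<Delta> c = c\<^sub>1 \<otimes> c\<^sub>2\<close> then
  \<open>tensor_lift sC sC b (\<Delta> c)\<close> is \<open>b c\<^sub>1 c\<^sub>2\<close>.
\<close>

definition tensor_rep ::
  "('k::field \<Rightarrow> 'v::ab_group_add \<Rightarrow> 'v) \<Rightarrow> ('k \<Rightarrow> 'w::ab_group_add \<Rightarrow> 'w) \<Rightarrow>
   (('v \<Rightarrow> 'w \<Rightarrow> 'k) \<Rightarrow> 'k) \<Rightarrow> ('v \<times> 'w) list" where
  "tensor_rep sV sW t = (SOME xs. t = (\<Sum>(v, w)\<leftarrow>xs. tensor sV sW v w))"

definition tensor_lift ::
  "('k::field \<Rightarrow> 'v::ab_group_add \<Rightarrow> 'v) \<Rightarrow> ('k \<Rightarrow> 'w::ab_group_add \<Rightarrow> 'w) \<Rightarrow>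
   ('v \<Rightarrow> 'w \<Rightarrow> 'u::ab_group_add) \<Rightarrow> (('v \<Rightarrow> 'w \<Rightarrow> 'k) \<Rightarrow> 'k) \<Rightarrow> 'u" where
  "tensor_lift sV sW b t = (\<Sum>(v, w)\<leftarrow>tensor_rep sV sW t. b v w)"


section \<open>Coalgebras and comodules\<close>

locale coalgebra = vector_space sC
  for sC :: "'k::field \<Rightarrow> 'c::ab_group_add \<Rightarrow> 'c" +
  fixes \<Delta> :: "'c \<Rightarrow> ('c \<Rightarrow> 'c \<Rightarrow> 'k) \<Rightarrow> 'k"
    and \<epsilon> :: "'c \<Rightarrow> 'k"
  assumes comult_mem: "\<Delta> c \<in> tensor_space sC sC UNIV UNIV"
    and comult_linear: "Vector_Spaces.linear sC (fun_scale (*)) \<Delta>"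
    and counit_linear: "Vector_Spaces.linear sC (*) \<epsilon>"
    and coassoc:
      "tensor_lift sC sC
         (\<lambda>x y. tensor_lift sC sC (\<lambda>x1 x2. tensor sC (fun_scale (*)) x1 (tensor sC sC x2 y)) (\<Delta> x))
         (\<Delta> c)
       = tensor_lift sC sC (\<lambda>x y. tensor sC (fun_scale (*)) x (\<Delta> y)) (\<Delta> c)"
    and counit_left: "tensor_lift sC sC (\<lambda>x y. sC (\<epsilon> x) y) (\<Delta> c) = c"
    and counit_right: "tensor_lift sC sC (\<lambda>x y. sC (\<epsilon> y) x) (\<Delta> c) = c"

text \<open>\<open>sweedler2 sC \<Delta> b c\<close> is \<open>b c\<^sub>1 c\<^sub>2\<close> and \<open>sweedler3 sC \<Delta> b c\<close> is \<open>b c\<^sub>1 c\<^sub>2 c\<^sub>3\<close>.\<close>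

definition sweedler2 ::
  "('k::field \<Rightarrow> 'c::ab_group_add \<Rightarrow> 'c) \<Rightarrow> ('c \<Rightarrow> ('c \<Rightarrow> 'c \<Rightarrow> 'k) \<Rightarrow> 'k) \<Rightarrow>
   ('c \<Rightarrow> 'c \<Rightarrow> 'u::ab_group_add) \<Rightarrow> 'c \<Rightarrow> 'u" where
  "sweedler2 sC \<Delta> b c = tensor_lift sC sC b (\<Delta> c)"

definition sweedler3 ::
  "('k::field \<Rightarrow> 'c::ab_group_add \<Rightarrow> 'c) \<Rightarrow> ('c \<Rightarrow> ('c \<Rightarrow> 'c \<Rightarrow> 'k) \<Rightarrow> 'k) \<Rightarrow>
   ('c \<Rightarrow> 'c \<Rightarrow> 'c \<Rightarrow> 'u::ab_group_add) \<Rightarrow> 'c \<Rightarrow> 'u" where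
  "sweedler3 sC \<Delta> b c = sweedler2 sC \<Delta> (\<lambda>x y. sweedler2 sC \<Delta> (\<lambda>y1 y2. b x y1 y2) y) c"

definition convolution ::
  "('k::field \<Rightarrow> 'c::ab_group_add \<Rightarrow> 'c) \<Rightarrow> ('c \<Rightarrow> ('c \<Rightarrow> 'c \<Rightarrow> 'k) \<Rightarrow> 'k) \<Rightarrow>
   ('c \<Rightarrow> 'k) \<Rightarrow> ('c \<Rightarrow> 'k) \<Rightarrow> 'c \<Rightarrow> 'k" where
  "convolution sC \<Delta> f g = (\<lambda>c. sweedler2 sC \<Delta> (\<lambda>x y. f x * g y) c)"

locale copivotal_coalgebra = coalgebra sC \<Delta> \<epsilon>
  for sC :: "'k::field \<Rightarrow> 'c::ab_group_add \<Rightarrow> 'c"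
    and \<Delta> :: "'c \<Rightarrow> ('c \<Rightarrow> 'c \<Rightarrow> 'k) \<Rightarrow> 'k"
    and \<epsilon> :: "'c \<Rightarrow> 'k" +
  fixes S :: "'c \<Rightarrow> 'c"
    and \<gamma> :: "'c \<Rightarrow> 'k"
    and \<gamma>bar :: "'c \<Rightarrow> 'k"
  assumes S_linear: "Vector_Spaces.linear sC sC S"
    and S_comult: "\<Delta> (S c) = sweedler2 sC \<Delta> (\<lambda>x y. tensor sC sC (S y) (S x)) c"
    and S_counit: "\<epsilon> (S c) = \<epsilon> c"
    and gamma_linear: "Vector_Spaces.linear sC (*) \<gamma>"
    and gammabar_linear: "Vector_Spaces.linear sC (*) \<gamma>bar"
    and gamma_conv_gammabar: "convolution sC \<Delta> \<gamma> \<gamma>bar = \<epsilon>"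
    and gammabar_conv_gamma: "convolution sC \<Delta> \<gamma>bar \<gamma> = \<epsilon>"
    and gammabar_eq: "\<gamma>bar = \<gamma> \<circ> S"
    and S_squared: "S (S c) = sweedler3 sC \<Delta> (\<lambda>x y z. sC (\<gamma> x * \<gamma>bar z) y) c"

definition coseparability_idempotent ::
  "('k::field \<Rightarrow> 'c::ab_group_add \<Rightarrow> 'c) \<Rightarrow> ('c \<Rightarrow> ('c \<Rightarrow> 'c \<Rightarrow> 'k) \<Rightarrow> 'k) \<Rightarrow>
   ('c \<Rightarrow> 'k) \<Rightarrow> ('c \<Rightarrow> 'c \<Rightarrow> 'k) \<Rightarrow> bool" where
  "coseparability_idempotent sC \<Delta> \<epsilon> lam \<longleftrightarrow>
     bilinear_map sC sC (*) lam \<and>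
     (\<forall>c d. sweedler2 sC \<Delta> (\<lambda>c1 c2. sC (lam c2 d) c1) c
          = sweedler2 sC \<Delta> (\<lambda>d1 d2. sC (lam c d1) d2) d) \<and>
     (\<forall>c. sweedler2 sC \<Delta> lam c = \<epsilon> c)"

locale right_comodule = coalgebra sC \<Delta> \<epsilon> + V: vector_space sV
  for sC :: "'k::field \<Rightarrow> 'c::ab_group_add \<Rightarrow> 'c"
    and \<Delta> :: "'c \<Rightarrow> ('c \<Rightarrow> 'c \<Rightarrow> 'k) \<Rightarrow> 'k"
    and \<epsilon> :: "'c \<Rightarrow> 'k"
    and sV :: "'k \<Rightarrow> 'v::ab_group_add \<Rightarrow> 'v" +
  fixes \<rho> :: "'v \<Rightarrow> ('v \<Rightarrow> 'c \<Rightarrow> 'k) \<Rightarrow> 'k"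
  assumes coaction_mem: "\<rho> v \<in> tensor_space sV sC UNIV UNIV"
    and coaction_linear: "Vector_Spaces.linear sV (fun_scale (*)) \<rho>"
    and coaction_coassoc:
      "tensor_lift sV sC
         (\<lambda>x c. tensor_lift sV sC (\<lambda>y d. tensor sV (fun_scale (*)) y (tensor sC sC d c)) (\<rho> x))
         (\<rho> v)
       = tensor_lift sV sC (\<lambda>x c. tensor sV (fun_scale (*)) x (\<Delta> c)) (\<rho> v)"
    and coaction_counit: "tensor_lift sV sC (\<lambda>x c. sV (\<epsilon> c) x) (\<rho> v) = v"

text \<open>The action \<open>l \<rightharpoonup> v = v\<^sub>0 l(v\<^sub>1)\<close> of the dual of \<open>C\<close> on a right \<open>C\<close>-comodule.\<close>

definition dual_action ::
  "('k::field \<Rightarrow> 'c::ab_group_add \<Rightarrow> 'c) \<Rightarrow> ('k \<Rightarrow> 'v::ab_group_add \<Rightarrow> 'v) \<Rightarrow>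
   ('v \<Rightarrow> ('v \<Rightarrow> 'c \<Rightarrow> 'k) \<Rightarrow> 'k) \<Rightarrow> ('c \<Rightarrow> 'k) \<Rightarrow> 'v \<Rightarrow> 'v" where
  "dual_action sC sV \<rho> l v = tensor_lift sV sC (\<lambda>x c. sV (l c) x) (\<rho> v)"

definition dual_space :: "('k::field \<Rightarrow> 'v::ab_group_add \<Rightarrow> 'v) \<Rightarrow> ('v \<Rightarrow> 'k) set" where
  "dual_space sV = {f. Vector_Spaces.linear sV (*) f}"

text \<open>
  The element \<open>f\<^sub>0 \<otimes> f\<^sub>1\<close> of \<open>V\<^sup>\<or> \<otimes> C\<close> with \<open>f\<^sub>0(v) f\<^sub>1 = f(v\<^sub>0) S(v\<^sub>1)\<close> for all \<open>v\<close>; for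
  finite-dimensional \<open>V\<close> it exists and is unique.
\<close>

definition dual_coaction ::
  "('k::field \<Rightarrow> 'c::ab_group_add \<Rightarrow> 'c) \<Rightarrow> ('c \<Rightarrow> 'c) \<Rightarrow> ('k \<Rightarrow> 'v::ab_group_add \<Rightarrow> 'v) \<Rightarrow>
   ('v \<Rightarrow> ('v \<Rightarrow> 'c \<Rightarrow> 'k) \<Rightarrow> 'k) \<Rightarrow>
   ('v \<Rightarrow> 'k) \<Rightarrow> (('v \<Rightarrow> 'k) \<Rightarrow> 'c \<Rightarrow> 'k) \<Rightarrow> 'k" where
  "dual_coaction sC S sV \<rho> f =
     (THE t. t \<in> tensor_space (fun_scale (*)) sC (dual_space sV) UNIV \<and>
        (\<forall>v. tensor_lift (fun_scale (*)) sC (\<lambda>g c. sC (g v) c) t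
           = tensor_lift sV sC (\<lambda>x c. sC (f x) (S c)) (\<rho> v)))"

text \<open>
  Comodule maps from \<open>V\<close> to a comodule whose underlying space is a subspace \<open>W\<close> of an ambient
  vector space (such as \<open>V\<^sup>\<or>\<close> inside all functions \<open>V \<rightarrow> k\<close>).
\<close>

definition comodule_homs ::
  "('k::field \<Rightarrow> 'c::ab_group_add \<Rightarrow> 'c) \<Rightarrow>
   ('k \<Rightarrow> 'v::ab_group_add \<Rightarrow> 'v) \<Rightarrow> ('v \<Rightarrow> ('v \<Rightarrow> 'c \<Rightarrow> 'k) \<Rightarrow> 'k) \<Rightarrow>
   ('k \<Rightarrow> 'w::ab_group_add \<Rightarrow> 'w) \<Rightarrow> 'w set \<Rightarrow> ('w \<Rightarrow> ('w \<Rightarrow> 'c \<Rightarrow> 'k) \<Rightarrow> 'k) \<Rightarrow>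
   ('v \<Rightarrow> 'w) set" where
  "comodule_homs sC sV \<rho> sW W \<sigma> =
     {f. Vector_Spaces.linear sV sW f \<and> range f \<subseteq> W \<and>
         (\<forall>v. \<sigma> (f v) = tensor_lift sV sC (\<lambda>x c. tensor sW sC (f x) c) (\<rho> v))}"


section \<open>Indicator and character\<close>

text \<open>
  The trace of an endomorphism \<open>T\<close> of a finite-dimensional subspace \<open>W\<close>, as the sum of the
  diagonal matrix entries of \<open>T\<close> in some basis of \<open>W\<close>.
\<close>

definition trace_on ::
  "('k::field \<Rightarrow> 'w::ab_group_add \<Rightarrow> 'w) \<Rightarrow> 'w set \<Rightarrow> ('w \<Rightarrow> 'w) \<Rightarrow> 'k" where
  "trace_on s W T =
     (let B = (SOME B. \<not> module.dependent s B \<and> module.span s B = W)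
      in \<Sum>b\<in>B. module.representation s B (T b) b)"

text \<open>The map \<open>j\<^sub>V : V \<rightarrow> V\<^sup>\<or>\<^sup>\<or>\<close> with \<open>j\<^sub>V(v)(f) = f(\<gamma> \<rightharpoonup> v)\<close>.\<close>

definition canonical_bidual_map ::
  "('k::field \<Rightarrow> 'c::ab_group_add \<Rightarrow> 'c) \<Rightarrow> ('c \<Rightarrow> 'k) \<Rightarrow>
   ('k \<Rightarrow> 'v::ab_group_add \<Rightarrow> 'v) \<Rightarrow> ('v \<Rightarrow> ('v \<Rightarrow> 'c \<Rightarrow> 'k) \<Rightarrow> 'k) \<Rightarrow>
   'v \<Rightarrow> ('v \<Rightarrow> 'k) \<Rightarrow> 'k" where
  "canonical_bidual_map sC \<gamma> sV \<rho> v = (\<lambda>f. f (dual_action sC sV \<rho> \<gamma> v))"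

definition transpose_map :: "('v \<Rightarrow> 'w) \<Rightarrow> ('w \<Rightarrow> 'k) \<Rightarrow> 'v \<Rightarrow> 'k" where
  "transpose_map f \<phi> = \<phi> \<circ> f"

definition fs_indicator ::
  "('k::field \<Rightarrow> 'c::ab_group_add \<Rightarrow> 'c) \<Rightarrow> ('c \<Rightarrow> 'c) \<Rightarrow> ('c \<Rightarrow> 'k) \<Rightarrow>
   ('k \<Rightarrow> 'v::ab_group_add \<Rightarrow> 'v) \<Rightarrow> ('v \<Rightarrow> ('v \<Rightarrow> 'c \<Rightarrow> 'k) \<Rightarrow> 'k) \<Rightarrow> 'k" where
  "fs_indicator sC S \<gamma> sV \<rho> =
     trace_on (fun_scale (fun_scale (*)))
       (comodule_homs sC sV \<rho> (fun_scale (*)) (dual_space sV) (dual_coaction sC S sV \<rho>))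
       (\<lambda>f. transpose_map f \<circ> canonical_bidual_map sC \<gamma> sV \<rho>)"

text \<open>
  The coefficients \<open>c\<^sub>i\<^sub>j\<close> in \<open>\<rho>(j) = \<Sum>\<^sub>i i \<otimes> c\<^sub>i\<^sub>j\<close>, for \<open>i\<close>, \<open>j\<close> in a basis \<open>B\<close> of \<open>V\<close>: apply the
  \<open>i\<close>-th coordinate function to the first factor of \<open>\<rho>(j)\<close>.
\<close>

definition coaction_coeff ::
  "('k::field \<Rightarrow> 'c::ab_group_add \<Rightarrow> 'c) \<Rightarrow> ('k \<Rightarrow> 'v::ab_group_add \<Rightarrow> 'v) \<Rightarrow>
   ('v \<Rightarrow> ('v \<Rightarrow> 'c \<Rightarrow> 'k) \<Rightarrow> 'k) \<Rightarrow> 'v set \<Rightarrow> 'v \<Rightarrow> 'v \<Rightarrow> 'c" where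
  "coaction_coeff sC sV \<rho> B i j =
     tensor_lift sV sC (\<lambda>x c. sC (module.representation sV B x i) c) (\<rho> j)"

text \<open>The character \<open>t\<^sub>V\<close>, computed in the basis \<open>B\<close>; it does not depend on \<open>B\<close>.\<close>

definition character ::
  "('k::field \<Rightarrow> 'c::ab_group_add \<Rightarrow> 'c) \<Rightarrow> ('k \<Rightarrow> 'v::ab_group_add \<Rightarrow> 'v) \<Rightarrow>
   ('v \<Rightarrow> ('v \<Rightarrow> 'c \<Rightarrow> 'k) \<Rightarrow> 'k) \<Rightarrow> 'v set \<Rightarrow> 'c" where
  "character sC sV \<rho> B = (\<Sum>i\<in>B. coaction_coeff sC sV \<rho> B i i)"


section \<open>Consistency of the definitions\<close>

lemma vector_space_fun_scale: "vector_space s \<Longrightarrow> vector_space (fun_scale s)"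
  by (simp add: vector_space_def fun_scale_def fun_eq_iff)

lemma vector_space_mult: "vector_space ((*) :: 'k::field \<Rightarrow> 'k \<Rightarrow> 'k)"
  by (simp add: vector_space_def algebra_simps)

lemma vector_space_tensor: "vector_space (fun_scale ((*) :: 'k::field \<Rightarrow> 'k \<Rightarrow> 'k))"
  by (rule vector_space_fun_scale[OF vector_space_mult])

lemma bilinear_tensor:
  assumes "vector_space sV" "vector_space sW"
  shows "bilinear_map sV sW (fun_scale (*)) (tensor sV sW)"
  using assms vector_space_tensor
  by (auto simp: bilinear_map_def Vector_Spaces.linear_iff tensor_def fun_scale_def fun_eq_iff)

lemma linear_functionals_separate:
  assumes sU: "vector_space sU"
    and eq: "\<And>\<phi>. Vector_Spaces.linear sU (*) \<phi> \<Longrightarrow> \<phi> x = \<phi> y"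
  shows "x = y"
proof (rule ccontr)
  assume ne: "x \<noteq> y"
  interpret U: vector_space sU by fact
  interpret P: vector_space_pair sU "(*)"
    by (intro vector_space_pair.intro sU vector_space_mult)
  have "U.independent {x - y}" using ne by simp
  then obtain \<phi> where \<phi>: "Vector_Spaces.linear sU (*) \<phi>" "\<phi> (x - y) = 1"
    using P.linear_independent_extend[of "{x - y}" "\<lambda>_. 1"] by auto
  have "\<phi> x = \<phi> (x - y) + \<phi> y"
    using \<phi>(1) by (metis Vector_Spaces.linear_iff diff_add_cancel)
  with eq[OF \<phi>(1)] \<phi>(2) show False by simp
qed

lemma tensor_sum_eq_imp:
  fixes b :: "'v::ab_group_add \<Rightarrow> 'w::ab_group_add \<Rightarrow> 'u::ab_group_add"
  assumes b: "bilinear_map sV sW sU b"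
    and eq: "(\<Sum>(v, w)\<leftarrow>xs. tensor sV sW v w) = (\<Sum>(v, w)\<leftarrow>ys. tensor sV sW v w)"
  shows "(\<Sum>(v, w)\<leftarrow>xs. b v w) = (\<Sum>(v, w)\<leftarrow>ys. b v w)"
proof -
  have sU: "vector_space sU"
    using b by (auto simp: bilinear_map_def Vector_Spaces.linear_iff)
  have ev: "\<phi> (\<Sum>(v, w)\<leftarrow>zs. b v w) = (\<Sum>(v, w)\<leftarrow>zs. tensor sV sW v w) (\<lambda>v w. \<phi> (b v w))"
    if \<phi>: "Vector_Spaces.linear sU (*) \<phi>" for \<phi> zs
  proof -
    have bil: "bilinear_map sV sW (*) (\<lambda>v w. \<phi> (b v w))"
      using b \<phi> by (auto simp: bilinear_map_def Vector_Spaces.linear_iff)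
    interpret L: Vector_Spaces.linear sU "(*)" \<phi> by fact
    show ?thesis
      by (induction zs) (auto simp: L.add tensor_def bil)
  qed
  show ?thesis
    by (rule linear_functionals_separate[OF sU]) (simp add: ev eq)
qed

lemma tensor_space_iff:
  assumes sV: "vector_space sV" and sW: "vector_space sW" and A: "module.subspace sV A"
  shows "t \<in> tensor_space sV sW A B \<longleftrightarrow>
    (\<exists>xs. set xs \<subseteq> A \<times> B \<and> t = (\<Sum>(v, w)\<leftarrow>xs. tensor sV sW v w))"
proof
  interpret V: vector_space sV by fact
  interpret W: vector_space sW by fact
  interpret T: vector_space "fun_scale (*) :: 'a \<Rightarrow> (('b \<Rightarrow> 'c \<Rightarrow> 'a) \<Rightarrow> 'a) \<Rightarrow> _"
    by (rule vector_space_tensor)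
  have sc: "fun_scale (*) a (tensor sV sW v w) = tensor sV sW (sV a v) w" for a v w
    using bilinear_tensor[OF sV sW] by (auto simp: bilinear_map_def Vector_Spaces.linear_iff)
  assume "t \<in> tensor_space sV sW A B"
  then have "t \<in> T.span {tensor sV sW v w |v w. v \<in> A \<and> w \<in> B}"
    by (simp add: tensor_space_def)
  then show "\<exists>xs. set xs \<subseteq> A \<times> B \<and> t = (\<Sum>(v, w)\<leftarrow>xs. tensor sV sW v w)"
  proof (induction rule: T.span_induct_alt)
    case base
    show ?case by (rule exI[of _ "[]"]) simp
  next
    case (step a x y)
    then obtain v w xs where "x = tensor sV sW v w" "v \<in> A" "w \<in> B"
      "set xs \<subseteq> A \<times> B" "y = (\<Sum>(v, w)\<leftarrow>xs. tensor sV sW v w)" by blast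
    then show ?case
      by (intro exI[of _ "(sV a v, w) # xs"]) (auto simp: sc V.subspace_scale[OF A])
  qed
next
  interpret T: vector_space "fun_scale (*) :: 'a \<Rightarrow> (('b \<Rightarrow> 'c \<Rightarrow> 'a) \<Rightarrow> 'a) \<Rightarrow> _"
    by (rule vector_space_tensor)
  assume "\<exists>xs. set xs \<subseteq> A \<times> B \<and> t = (\<Sum>(v, w)\<leftarrow>xs. tensor sV sW v w)"
  then obtain xs where "set xs \<subseteq> A \<times> B" "t = (\<Sum>(v, w)\<leftarrow>xs. tensor sV sW v w)" by blast
  then show "t \<in> tensor_space sV sW A B"
  proof (induction xs arbitrary: t)
    case Nil
    then show ?case using T.span_zero by (simp add: tensor_space_def del: zero_fun_apply)
  next
    case (Cons p xs)
    have "tensor sV sW (fst p) (snd p) \<in> tensor_space sV sW A B"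
      unfolding tensor_space_def using Cons.prems(1) by (intro T.span_base) force
    with Cons show ?case
      by (cases p) (auto simp: tensor_space_def simp del: plus_fun_apply intro: T.span_add)
  qed
qed

text \<open>The universal property: \<open>tensor_lift sV sW b\<close> is the unique linear map on \<open>V \<otimes> W\<close>
  taking \<open>v \<otimes> w\<close> to \<open>b v w\<close>.\<close>

lemma tensor_lift_sum:
  assumes b: "bilinear_map sV sW sU b"
  shows "tensor_lift sV sW b (\<Sum>(v, w)\<leftarrow>xs. tensor sV sW v w) = (\<Sum>(v, w)\<leftarrow>xs. b v w)"
proof -
  let ?t = "\<Sum>(v, w)\<leftarrow>xs. tensor sV sW v w"
  have "?t = (\<Sum>(v, w)\<leftarrow>tensor_rep sV sW ?t. tensor sV sW v w)"
    unfolding tensor_rep_def by (rule someI[of _ xs]) simp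
  from tensor_sum_eq_imp[OF b this] show ?thesis
    by (simp add: tensor_lift_def)
qed

lemma tensor_lift_tensor:
  assumes "bilinear_map sV sW sU b"
  shows "tensor_lift sV sW b (tensor sV sW v w) = b v w"
  using tensor_lift_sum[OF assms, of "[(v, w)]"] by simp

lemma tensor_space_UNIV_iff:
  assumes "vector_space sV" "vector_space sW"
  shows "t \<in> tensor_space sV sW UNIV UNIV \<longleftrightarrow> (\<exists>xs. t = (\<Sum>(v, w)\<leftarrow>xs. tensor sV sW v w))"
proof -
  interpret V: vector_space sV by fact
  show ?thesis using tensor_space_iff[OF assms V.subspace_UNIV, of t UNIV] by auto
qed

lemma tensor_lift_add:
  assumes b: "bilinear_map sV sW sU b" and sV: "vector_space sV" and sW: "vector_space sW"
    and "t \<in> tensor_space sV sW UNIV UNIV" "u \<in> tensor_space sV sW UNIV UNIV"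
  shows "tensor_lift sV sW b (t + u) = tensor_lift sV sW b t + tensor_lift sV sW b u"
proof -
  obtain xs ys where "t = (\<Sum>(v, w)\<leftarrow>xs. tensor sV sW v w)" "u = (\<Sum>(v, w)\<leftarrow>ys. tensor sV sW v w)"
    using assms by (auto simp: tensor_space_UNIV_iff)
  then show ?thesis
    using tensor_lift_sum[OF b, of xs] tensor_lift_sum[OF b, of ys]
      tensor_lift_sum[OF b, of "xs @ ys"] by simp
qed

lemma tensor_lift_scale:
  assumes b: "bilinear_map sV sW sU b" and sV: "vector_space sV" and sW: "vector_space sW"
    and "t \<in> tensor_space sV sW UNIV UNIV"
  shows "tensor_lift sV sW b (fun_scale (*) a t) = sU a (tensor_lift sV sW b t)"
proof -
  interpret U: vector_space sU
    using b by (auto simp: bilinear_map_def Vector_Spaces.linear_iff)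
  interpret T: vector_space "fun_scale (*) :: 'a \<Rightarrow> (('b \<Rightarrow> 'c \<Rightarrow> 'a) \<Rightarrow> 'a) \<Rightarrow> _"
    by (rule vector_space_tensor)
  obtain xs where t: "t = (\<Sum>(v, w)\<leftarrow>xs. tensor sV sW v w)"
    using assms by (auto simp: tensor_space_UNIV_iff)
  have "fun_scale (*) a t = (\<Sum>(v, w)\<leftarrow>map (\<lambda>(v, w). (sV a v, w)) xs. tensor sV sW v w)"
    unfolding t using bilinear_tensor[OF sV sW]
    by (induction xs) (auto simp: T.scale_right_distrib bilinear_map_def Vector_Spaces.linear_iff)
  moreover have "sU a (\<Sum>(v, w)\<leftarrow>xs. b v w) = (\<Sum>(v, w)\<leftarrow>map (\<lambda>(v, w). (sV a v, w)) xs. b v w)"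
    using b
    by (induction xs) (auto simp: U.scale_right_distrib bilinear_map_def Vector_Spaces.linear_iff)
  ultimately show ?thesis
    unfolding t using tensor_lift_sum[OF b] by metis
qed

lemma tensor_lift_unique:
  assumes b: "bilinear_map sV sW sU b" and sV: "vector_space sV" and sW: "vector_space sW"
    and F: "\<And>t u. t \<in> tensor_space sV sW UNIV UNIV \<Longrightarrow> u \<in> tensor_space sV sW UNIV UNIV \<Longrightarrow>
              F (t + u) = F t + F u"
    and Ft: "\<And>v w. F (tensor sV sW v w) = b v w"
    and t: "t \<in> tensor_space sV sW UNIV UNIV"
  shows "F t = tensor_lift sV sW b t"
proof -
  have mem: "(\<Sum>(v, w)\<leftarrow>xs. tensor sV sW v w) \<in> tensor_space sV sW UNIV UNIV" for xs
    using tensor_space_UNIV_iff[OF sV sW] by blast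
  have F0: "F 0 = 0"
    using F[OF mem[of "[]"] mem[of "[]"]] by simp
  obtain xs where xs: "t = (\<Sum>(v, w)\<leftarrow>xs. tensor sV sW v w)"
    using t by (auto simp: tensor_space_UNIV_iff[OF sV sW])
  have "F (\<Sum>(v, w)\<leftarrow>xs. tensor sV sW v w) = (\<Sum>(v, w)\<leftarrow>xs. b v w)"
  proof (induction xs)
    case (Cons p xs)
    show ?case
      using F[OF mem[of "[p]"] mem[of xs]] Cons Ft by (cases p) (simp del: plus_fun_apply)
  qed (simp add: F0 del: zero_fun_apply)
  then show ?thesis by (simp add: xs tensor_lift_sum[OF b])
qed

context right_comodule
begin

lemma coaction_eq_sum_coeff:
  assumes "finite B" "V.independent B" "V.span B = UNIV"
  shows "\<rho> j = (\<Sum>i\<in>B. tensor sV sC i (coaction_coeff sC sV \<rho> B i j))"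
proof -
  have sV: "vector_space sV" and sC: "vector_space sC" by unfold_locales
  note lin_rep = V.linear_representation[OF assms(2,3), unfolded Vector_Spaces.linear_iff]
  obtain xs where xs: "\<rho> j = (\<Sum>(v, w)\<leftarrow>xs. tensor sV sC v w)"
    using coaction_mem tensor_space_UNIV_iff[OF sV sC] by blast
  have b: "bilinear_map sV sC sC (\<lambda>x c. sC (V.representation B x i) c)" for i
    using lin_rep sV sC
    by (auto simp: bilinear_map_def Vector_Spaces.linear_iff scale_right_distrib
        scale_left_distrib mult.commute)
  have bt: "tensor sV sC v (x + y) = tensor sV sC v x + tensor sV sC v y"
    "tensor sV sC (v + v') x = tensor sV sC v x + tensor sV sC v' x"
    "tensor sV sC v (sC a x) = fun_scale (*) a (tensor sV sC v x)"
    "tensor sV sC (sV a v) x = fun_scale (*) a (tensor sV sC v x)" for v v' x y a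
    using bilinear_tensor[OF sV sC] by (auto simp: bilinear_map_def Vector_Spaces.linear_iff)
  have t0: "tensor sV sC 0 x = 0" "tensor sV sC x' 0 = 0" for x x'
    using bt(2)[of 0 0 x] bt(1)[of x' 0 0] by simp_all
  have tsum: "tensor sV sC (\<Sum>i\<in>I. f i) x = (\<Sum>i\<in>I. tensor sV sC (f i) x)" for I f x
    by (induction I rule: infinite_finite_induct) (simp_all add: bt t0 del: plus_fun_apply zero_fun_apply)
  have rep: "(\<Sum>i\<in>B. sV (V.representation B v i) i) = v" for v
    using assms by (intro V.sum_representation_eq) auto
  have "(\<Sum>(v, w)\<leftarrow>xs. tensor sV sC v w) =
      (\<Sum>i\<in>B. tensor sV sC i (\<Sum>(v, w)\<leftarrow>xs. sC (V.representation B v i) w))"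
  proof (induction xs)
    case Nil
    show ?case by (simp add: t0 del: zero_fun_apply)
  next
    case (Cons p xs)
    obtain v c where p: "p = (v, c)" by (cases p)
    have "tensor sV sC v c = tensor sV sC (\<Sum>i\<in>B. sV (V.representation B v i) i) c"
      by (simp add: rep)
    also have "\<dots> = (\<Sum>i\<in>B. tensor sV sC i (sC (V.representation B v i) c))"
      by (simp add: tsum bt)
    finally show ?case by (simp add: Cons p bt sum.distrib del: plus_fun_apply)
  qed
  then show ?thesis
    unfolding xs coaction_coeff_def tensor_lift_sum[OF b] .
qed

lemma dual_coaction_ex1:
  assumes S: "Vector_Spaces.linear sC sC S" and f: "f \<in> dual_space sV"
    and B: "finite B" "V.independent B" "V.span B = UNIV"
  shows "\<exists>!t. t \<in> tensor_space (fun_scale (*)) sC (dual_space sV) UNIV \<and>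
        (\<forall>v. tensor_lift (fun_scale (*)) sC (\<lambda>g c. sC (g v) c) t
           = tensor_lift sV sC (\<lambda>x c. sC (f x) (S c)) (\<rho> v))"
proof -
  let ?sD = "fun_scale (*) :: 'k \<Rightarrow> ('v \<Rightarrow> 'k) \<Rightarrow> _"
  let ?ev = "\<lambda>v (g :: 'v \<Rightarrow> 'k) c. sC (g v) c"
  let ?d = "\<lambda>b v. V.representation B v b"
  define F where "F v = tensor_lift sV sC (\<lambda>x c. sC (f x) (S c)) (\<rho> v)" for v
  have sV: "vector_space sV" and sC: "vector_space sC" by unfold_locales
  have sD: "vector_space ?sD" by (rule vector_space_tensor)
  interpret D: vector_space ?sD by (rule sD)
  have evb: "bilinear_map ?sD sC sC (?ev v)" for v
    using sD sC
    by (auto simp: bilinear_map_def Vector_Spaces.linear_iff scale_right_distrib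
        scale_left_distrib mult.commute fun_scale_def)
  have Fb: "bilinear_map sV sC sC (\<lambda>x c. sC (f x) (S c))"
    using S f sV sC
    by (auto simp: bilinear_map_def Vector_Spaces.linear_iff scale_right_distrib
        scale_left_distrib mult.commute dual_space_def)
  have Flin: "Vector_Spaces.linear sV sC F"
    using sV sC coaction_linear coaction_mem tensor_lift_add[OF Fb sV sC] tensor_lift_scale[OF Fb sV sC]
    by (simp add: Vector_Spaces.linear_iff F_def)
  interpret F: Vector_Spaces.linear sV sC F by (rule Flin)
  have rep: "(\<Sum>i\<in>B. sV (V.representation B v i) i) = v" for v
    using B by (intro V.sum_representation_eq) auto
  have Frep: "(\<Sum>b\<in>B. sC (?d b v) (F b)) = F v" for v
    by (subst (2) rep[of v, symmetric]) (simp add: F.sum F.scale)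
  have dmem: "?d b \<in> dual_space sV" for b
    using V.linear_representation[OF B(2,3)] by (simp add: dual_space_def)
  have sub: "D.subspace (dual_space sV)"
    using sV vector_space_mult
    by (auto simp: D.subspace_def dual_space_def Vector_Spaces.linear_iff fun_scale_def algebra_simps)
  obtain bs where bs: "set bs = B" "distinct bs" using finite_distinct_list[OF B(1)] by blast
  have sumB: "(\<Sum>b\<leftarrow>bs. h b) = (\<Sum>b\<in>B. h b)" for h :: "'v \<Rightarrow> 'z::comm_monoid_add"
    using sum_list_distinct_conv_sum_set[OF bs(2), of h] by (simp add: bs(1))
  note T = tensor_space_iff[OF sD sC sub, of _ UNIV]
  show ?thesis unfolding F_def[symmetric]
  proof (rule ex1I)
    let ?xs = "map (\<lambda>b. (?d b, F b)) bs"
    show "(\<Sum>(v, w)\<leftarrow>?xs. tensor ?sD sC v w) \<in> tensor_space ?sD sC (dual_space sV) UNIV \<and>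
      (\<forall>v. tensor_lift ?sD sC (?ev v) (\<Sum>(v, w)\<leftarrow>?xs. tensor ?sD sC v w) = F v)"
    proof (intro conjI allI)
      show "(\<Sum>(v, w)\<leftarrow>?xs. tensor ?sD sC v w) \<in> tensor_space ?sD sC (dual_space sV) UNIV"
        unfolding T by (rule exI[of _ ?xs]) (auto simp: dmem)
      fix v
      show "tensor_lift ?sD sC (?ev v) (\<Sum>(v, w)\<leftarrow>?xs. tensor ?sD sC v w) = F v"
        unfolding tensor_lift_sum[OF evb] by (simp add: o_def sumB Frep)
    qed
  next
    fix t
    assume t: "t \<in> tensor_space ?sD sC (dual_space sV) UNIV \<and> (\<forall>v. tensor_lift ?sD sC (?ev v) t = F v)"
    then obtain xs where xs: "set xs \<subseteq> dual_space sV \<times> UNIV"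
      "t = (\<Sum>(v, w)\<leftarrow>xs. tensor ?sD sC v w)" unfolding T by blast
    have bt: "tensor ?sD sC v (x + y) = tensor ?sD sC v x + tensor ?sD sC v y"
      "tensor ?sD sC (v + v') x = tensor ?sD sC v x + tensor ?sD sC v' x"
      "tensor ?sD sC v (sC a x) = fun_scale (*) a (tensor ?sD sC v x)"
      "tensor ?sD sC (?sD a v) x = fun_scale (*) a (tensor ?sD sC v x)" for v v' x y a
      using bilinear_tensor[OF sD sC] by (auto simp: bilinear_map_def Vector_Spaces.linear_iff)
    have t0: "tensor ?sD sC 0 x = 0" "tensor ?sD sC x' 0 = 0" for x x'
      using bt(2)[of 0 0 x] bt(1)[of x' 0 0] by simp_all
    have tsum: "tensor ?sD sC (\<Sum>i\<in>I. h i) x = (\<Sum>i\<in>I. tensor ?sD sC (h i) x)"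
      for I :: "'v set" and h x
      by (induction I rule: infinite_finite_induct) (simp_all add: bt t0 del: plus_fun_apply zero_fun_apply)
    have exp: "g = (\<Sum>b\<in>B. ?sD (g b) (?d b))" if "g \<in> dual_space sV" for g
    proof
      fix v
      interpret g: Vector_Spaces.linear sV "(*)" g using that by (simp add: dual_space_def)
      have app: "(\<Sum>b\<in>I. ?sD (g b) (?d b)) v = (\<Sum>b\<in>I. g b * ?d b v)" for I
        by (induction I rule: infinite_finite_induct) (simp_all add: fun_scale_def)
      show "g v = (\<Sum>b\<in>B. ?sD (g b) (?d b)) v"
        by (subst (1) rep[of v, symmetric]) (simp add: g.sum g.scale app mult.commute)
    qed
    have "t = (\<Sum>b\<in>B. tensor ?sD sC (?d b) (\<Sum>(g, c)\<leftarrow>xs. sC (g b) c))"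
      using xs(1) unfolding xs(2)
    proof (induction xs)
      case Nil
      show ?case by (simp add: t0 del: zero_fun_apply)
    next
      case (Cons p xs)
      obtain g c where p: "p = (g, c)" by (cases p)
      with Cons have g: "g \<in> dual_space sV" by simp
      have "tensor ?sD sC g c = tensor ?sD sC (\<Sum>b\<in>B. ?sD (g b) (?d b)) c"
        using exp[OF g] by (rule arg_cong)
      also have "\<dots> = (\<Sum>b\<in>B. tensor ?sD sC (?d b) (sC (g b) c))"
        by (simp only: tsum bt)
      finally show ?case using Cons by (simp add: p bt sum.distrib del: plus_fun_apply)
    qed
    also have "\<dots> = (\<Sum>b\<in>B. tensor ?sD sC (?d b) (F b))"
      using t unfolding xs(2) tensor_lift_sum[OF evb] by (simp add: split_beta)
    finally show "t = (\<Sum>(v, w)\<leftarrow>map (\<lambda>b. (?d b, F b)) bs. tensor ?sD sC v w)"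
      by (simp add: o_def sumB)
  qed
qed

end

end

theory Submission
  imports Defs
begin

text \<open>
  Let \<open>\<rho>(v\<^sub>j) = \<Sum>\<^sub>i v\<^sub>i \<otimes> c\<^sub>i\<^sub>j\<close>. Viewing a comodule map \<open>V \<rightarrow> V\<^sup>\<or>\<close> as a bilinear form \<open>f\<close> on \<open>V\<close>, the
  endomorphism whose trace is \<open>\<nu>(V)\<close> becomes \<open>f(v, w) \<mapsto> f(w, \<gamma> \<rightharpoonup> v)\<close>; it preserves comodule maps
  because \<open>S\<^sup>2(c\<^sub>1) \<gamma>(c\<^sub>2) = \<gamma>(c\<^sub>1) c\<^sub>2\<close>. As for a separable algebra, \<open>\<lambda>\<close> gives a projection of all
  forms onto the comodule maps, \<open>f \<mapsto> f(v\<^sub>0)\<^sub>0 \<lambda>(f(v\<^sub>0)\<^sub>1, v\<^sub>1)\<close>. The images of the elementary forms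
  under it, together with the entries \<open>f \<mapsto> f(v\<^sub>l, v\<^sub>m)\<close>, are a frame of the space of comodule maps,
  from which the trace is read off.
\<close>

section \<open>Traces computed from a frame\<close>

lemma sum_fun_app: "(\<Sum>x\<in>A. f x) v = (\<Sum>x\<in>A. f x v)"
  by (induction A rule: infinite_finite_induct) simp_all

text \<open>The family \<open>w\<close> need not be linearly independent.\<close>

lemma trace_on_frame:
  fixes \<phi> :: "'x \<Rightarrow> 'w::ab_group_add \<Rightarrow> 'k::field"
  assumes s: "vector_space s" and W: "module.subspace s W" and X: "finite X"
    and w: "\<And>x. x \<in> X \<Longrightarrow> w x \<in> W"
    and \<phi>: "\<And>x. x \<in> X \<Longrightarrow> Vector_Spaces.linear s (*) (\<phi> x)"
    and frame: "\<And>u. u \<in> W \<Longrightarrow> u = (\<Sum>x\<in>X. s (\<phi> x u) (w x))"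
    and T: "Vector_Spaces.linear s s T" and TW: "\<And>u. u \<in> W \<Longrightarrow> T u \<in> W"
  shows "trace_on s W T = (\<Sum>x\<in>X. \<phi> x (T (w x)))"
proof -
  interpret vector_space s by fact
  interpret T: Vector_Spaces.linear s s T by fact
  \<comment> \<open>This is the basis hidden in \<open>trace_on\<close>. Its properties follow only
    once some basis of \<open>W\<close> is exhibited, which \<open>B0\<close> does.\<close>
  define \<beta> where "\<beta> = (SOME B. independent B \<and> span B = W)"
  obtain B0 where "B0 \<subseteq> W" "independent B0" "W \<subseteq> span B0"
    using maximal_independent_subset[of W] by metis
  then have "independent B0 \<and> span B0 = W"
    using span_minimal[of B0 W] W by auto
  then have "independent \<beta> \<and> span \<beta> = W"
    unfolding \<beta>_def by (rule someI)
  then have \<beta>: "independent \<beta>" "span \<beta> = W" by auto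
  have \<beta>W: "b \<in> W" if "b \<in> \<beta>" for b
    using \<beta>(2) span_base[OF that] by simp
  \<comment> \<open>The finite frame spans \<open>W\<close>, so the independent set
    \<open>\<beta>\<close> is finite; for an infinite one the sum in \<open>trace_on\<close> would
    default to 0.\<close>
  have "\<beta> \<subseteq> span (w ` X)"
  proof
    fix b assume "b \<in> \<beta>"
    then have "b = (\<Sum>x\<in>X. s (\<phi> x b) (w x))" by (intro frame \<beta>W)
    moreover have "\<dots> \<in> span (w ` X)"
      by (intro span_sum span_scale span_base) auto
    ultimately show "b \<in> span (w ` X)" by simp
  qed
  then have fin: "finite \<beta>"
    using independent_span_bound[OF _ \<beta>(1)] X by blast
  have rep_T: "representation \<beta> (T b) b = (\<Sum>x\<in>X. \<phi> x b * representation \<beta> (T (w x)) b)"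
    if "b \<in> \<beta>" for b
  proof -
    have "T b = (\<Sum>x\<in>X. s (\<phi> x b) (T (w x)))"
      by (subst frame[OF \<beta>W[OF that]]) (simp add: T.sum T.scale)
    moreover have "T (w x) \<in> span \<beta>" if "x \<in> X" for x
      using \<beta>(2) w[OF that] TW by simp
    ultimately show ?thesis
      using \<beta>(1) by (simp add: representation_sum representation_scale span_scale)
  qed
  \<comment> \<open>Summing over \<open>\<beta>\<close> first reassembles \<open>T (w x)\<close>
    from its coordinates, so swapping the two sums removes the basis from the trace.\<close>
  have \<phi>_T: "(\<Sum>b\<in>\<beta>. \<phi> x b * representation \<beta> (T (w x)) b) = \<phi> x (T (w x))" if "x \<in> X" for x
  proof -
    interpret L: Vector_Spaces.linear s "(*)" "\<phi> x" using \<phi>[OF that] .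
    have "T (w x) = (\<Sum>b\<in>\<beta>. s (representation \<beta> (T (w x)) b) b)"
      using \<beta> fin w[OF that] TW by (intro sum_representation_eq[symmetric]) auto
    then have "\<phi> x (T (w x)) = \<phi> x (\<Sum>b\<in>\<beta>. s (representation \<beta> (T (w x)) b) b)" by simp
    then show ?thesis by (simp add: L.sum L.scale mult.commute)
  qed
  have "trace_on s W T = (\<Sum>b\<in>\<beta>. representation \<beta> (T b) b)"
    by (simp add: trace_on_def Let_def \<beta>_def)
  also have "\<dots> = (\<Sum>x\<in>X. \<Sum>b\<in>\<beta>. \<phi> x b * representation \<beta> (T (w x)) b)"
    by (subst sum.swap) (simp add: rep_T)
  also have "\<dots> = (\<Sum>x\<in>X. \<phi> x (T (w x)))"
    by (simp add: \<phi>_T)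
  finally show ?thesis .
qed

section \<open>Linear maps out of tensor products\<close>

lemma bilinear_mapI:
  assumes "vector_space sV" "vector_space sW" "vector_space sU"
    and "\<And>v w w'. b v (w + w') = b v w + b v w'" "\<And>a v w. b v (sW a w) = sU a (b v w)"
    and "\<And>v v' w. b (v + v') w = b v w + b v' w" "\<And>a v w. b (sV a v) w = sU a (b v w)"
  shows "bilinear_map sV sW sU b"
  using assms by (simp add: bilinear_map_def Vector_Spaces.linear_iff)

lemma tensor_lift_sum_set:
  fixes x :: "'x \<Rightarrow> 'v::ab_group_add"
  assumes b: "bilinear_map sV sW sU b" and A: "finite A"
  shows "tensor_lift sV sW b (\<Sum>k\<in>A. tensor sV sW (x k) (y k)) = (\<Sum>k\<in>A. b (x k) (y k))"
proof -
  obtain ks where ks: "set ks = A" "distinct ks"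
    using finite_distinct_list[OF A] by blast
  have sumA: "(\<Sum>k\<leftarrow>ks. h k) = (\<Sum>k\<in>A. h k)" for h :: "'x \<Rightarrow> 'z::comm_monoid_add"
    using sum_list_distinct_conv_sum_set[OF ks(2), of h] by (simp add: ks(1))
  show ?thesis
    using tensor_lift_sum[OF b, of "map (\<lambda>k. (x k, y k)) ks"] by (simp add: o_def sumA)
qed

text \<open>Linearity of \<open>tensor_lift\<close> is available only on genuine tensors, since
  elsewhere \<open>tensor_rep\<close> is an arbitrary list; hence the hypothesis \<open>mem\<close>.
  It is applied to \<rho> and \<Delta>.\<close>

lemma linear_tensor_lift:
  assumes b: "bilinear_map sV sW sU b" and h: "Vector_Spaces.linear sA (fun_scale (*)) h"
    and mem: "\<And>a. h a \<in> tensor_space sV sW UNIV UNIV"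
  shows "Vector_Spaces.linear sA sU (\<lambda>a. tensor_lift sV sW b (h a))"
proof -
  have vs: "vector_space sV" "vector_space sW" "vector_space sU"
    using b by (auto simp: bilinear_map_def Vector_Spaces.linear_iff)
  show ?thesis
    using h vs by (simp add: Vector_Spaces.linear_iff mem
        tensor_lift_add[OF b vs(1,2)] tensor_lift_scale[OF b vs(1,2)])
qed

text \<open>Both sides are sums over the one list \<open>tensor_rep sV sW t\<close>, so the identity
  is termwise. It serves for linearity in a parameter of the map being lifted, as opposed to
  linearity in the tensor.\<close>

lemma tensor_lift_add_fun:
  "tensor_lift sV sW (\<lambda>v w. b v w + b' v w) t = tensor_lift sV sW b t + tensor_lift sV sW b' t"
  by (simp add: tensor_lift_def case_prod_unfold sum_list_addf)

lemma tensor_lift_scale_fun: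
  assumes "vector_space s"
  shows "tensor_lift sV sW (\<lambda>v w. s a (b v w)) t = s a (tensor_lift sV sW b t)"
proof -
  interpret vector_space s by fact
  have "(\<Sum>(v, w)\<leftarrow>xs. s a (b v w)) = s a (\<Sum>(v, w)\<leftarrow>xs. b v w)" for xs
    by (induction xs) (auto simp: scale_right_distrib)
  then show ?thesis by (simp add: tensor_lift_def)
qed

section \<open>Matrix coefficients of a comodule\<close>

locale comodule_with_basis = right_comodule sC \<Delta> \<epsilon> sV \<rho>
  for sC :: "'k::field \<Rightarrow> 'c::ab_group_add \<Rightarrow> 'c"
    and \<Delta> :: "'c \<Rightarrow> ('c \<Rightarrow> 'c \<Rightarrow> 'k) \<Rightarrow> 'k"
    and \<epsilon> :: "'c \<Rightarrow> 'k"
    and sV :: "'k \<Rightarrow> 'v::ab_group_add \<Rightarrow> 'v"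
    and \<rho> :: "'v \<Rightarrow> ('v \<Rightarrow> 'c \<Rightarrow> 'k) \<Rightarrow> 'k" +
  fixes B :: "'v set"
  assumes finite_B: "finite B" and indep_B: "V.independent B" and span_B: "V.span B = UNIV"
begin

abbreviation coef where "coef \<equiv> coaction_coeff sC sV \<rho> B"
abbreviation coord where "coord i v \<equiv> V.representation B v i"

lemma vs: "vector_space sC" "vector_space sV"
  by unfold_locales

lemma linear_coord: "Vector_Spaces.linear sV (*) (coord i)"
  using V.linear_representation[OF indep_B span_B] .

lemma coord_simps [simp]:
  "coord i (v + w) = coord i v + coord i w" "coord i (sV a v) = a * coord i v"
  using linear_coord[unfolded Vector_Spaces.linear_iff] by auto

lemma coord_basis: "j \<in> B \<Longrightarrow> coord i j = (if i = j then 1 else 0)"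
  using V.representation_basis[OF indep_B] by auto

lemma sum_coord: "(\<Sum>i\<in>B. sV (coord i v) i) = v"
  using finite_B indep_B span_B by (intro V.sum_representation_eq) auto

lemma linear_eq_sum_coord:
  assumes "Vector_Spaces.linear sV sU h"
  shows "h v = (\<Sum>j\<in>B. sU (coord j v) (h j))"
proof -
  interpret h: Vector_Spaces.linear sV sU h by fact
  show ?thesis by (subst (1) sum_coord[of v, symmetric]) (simp add: h.sum h.scale)
qed

lemma tensor_lift_coaction:
  assumes "bilinear_map sV sC sU b"
  shows "tensor_lift sV sC b (\<rho> j) = (\<Sum>i\<in>B. b i (coef i j))"
  by (subst coaction_eq_sum_coeff[OF finite_B indep_B span_B])
    (rule tensor_lift_sum_set[OF assms finite_B])

text \<open>This is coassociativity of the coaction compared at the basis vector \<open>k\<close> in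
  the first tensor factor; the coefficients comultiply like a matrix product.\<close>

lemma comult_coef:
  assumes "k \<in> B"
  shows "\<Delta> (coef k j) = (\<Sum>i\<in>B. tensor sC sC (coef k i) (coef i j))"
proof -
  have vsT: "vector_space (fun_scale (*) :: 'k \<Rightarrow> (('c \<Rightarrow> 'c \<Rightarrow> 'k) \<Rightarrow> 'k) \<Rightarrow> _)"
    by (rule vector_space_tensor)
  interpret T: vector_space "fun_scale (*) :: 'k \<Rightarrow> (('c \<Rightarrow> 'c \<Rightarrow> 'k) \<Rightarrow> 'k) \<Rightarrow> _"
    by (rule vsT)
  note tensor_C = bilinear_tensor[OF vs(1,1), unfolded bilinear_map_def Vector_Spaces.linear_iff]
  note tensor_V = bilinear_tensor[OF vs(2) vsT, unfolded bilinear_map_def Vector_Spaces.linear_iff]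
  note comult = comult_linear[unfolded Vector_Spaces.linear_iff]
  let ?p = "\<lambda>x (t :: ('c \<Rightarrow> 'c \<Rightarrow> 'k) \<Rightarrow> 'k). fun_scale (*) (coord k x) t"
  have p: "bilinear_map sV (fun_scale (*)) (fun_scale (*)) ?p"
    using vs vsT T.scale_right_distrib T.scale_left_distrib
    by (intro bilinear_mapI) (simp_all del: plus_fun_apply add: mult.commute)
  have inner: "bilinear_map sV sC (fun_scale (*))
      (\<lambda>y d. tensor sV (fun_scale (*)) y (tensor sC sC d c))" for c
    using tensor_C tensor_V by (intro bilinear_mapI vs vector_space_tensor) auto
  have outer: "bilinear_map sV sC (fun_scale (*))
      (\<lambda>x c. tensor_lift sV sC (\<lambda>y d. tensor sV (fun_scale (*)) y (tensor sC sC d c)) (\<rho> x))"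
    using linear_tensor_lift[OF inner coaction_linear coaction_mem, unfolded Vector_Spaces.linear_iff]
      tensor_C tensor_V
    by (intro bilinear_mapI vs vector_space_tensor)
      (simp_all del: plus_fun_apply add: tensor_lift_add_fun tensor_lift_scale_fun[OF vector_space_tensor])
  have right: "bilinear_map sV sC (fun_scale (*)) (\<lambda>x c. tensor sV (fun_scale (*)) x (\<Delta> c))"
    using tensor_V comult by (intro bilinear_mapI vs vector_space_tensor) auto
  \<comment> \<open>Contracting the first factor with the coordinate function of \<open>k\<close>
    isolates one component of a sum indexed by the basis.\<close>
  have L: "tensor_lift sV (fun_scale (*)) ?p
       (\<Sum>i\<in>B. tensor sV (fun_scale (*)) i (h i)) = h k" for h
    using assms by (simp add: tensor_lift_sum_set[OF p finite_B] coord_basis if_distrib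
        [of "\<lambda>a. fun_scale (*) a _"] finite_B cong: if_cong)
  have "(\<Sum>i\<in>B. \<Sum>l\<in>B. tensor sV (fun_scale (*)) l (tensor sC sC (coef l i) (coef i j)))
     = (\<Sum>i\<in>B. tensor sV (fun_scale (*)) i (\<Delta> (coef i j)))"
    using coaction_coassoc[of j]
    unfolding tensor_lift_coaction[OF outer] tensor_lift_coaction[OF right]
    by (simp only: tensor_lift_coaction[OF inner])
  \<comment> \<open>Collecting the terms with the same basis vector \<open>l\<close> in the first
    factor gives the shape that \<open>L\<close> can contract.\<close>
  also have "(\<Sum>i\<in>B. \<Sum>l\<in>B. tensor sV (fun_scale (*)) l (tensor sC sC (coef l i) (coef i j)))
     = (\<Sum>l\<in>B. tensor sV (fun_scale (*)) l (\<Sum>i\<in>B. tensor sC sC (coef l i) (coef i j)))"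
  proof -
    have "tensor sV (fun_scale (*)) l (\<Sum>i\<in>B. h i) = (\<Sum>i\<in>B. tensor sV (fun_scale (*)) l (h i))"
      for l and h :: "'v \<Rightarrow> ('c \<Rightarrow> 'c \<Rightarrow> 'k) \<Rightarrow> 'k"
    proof -
      interpret l: Vector_Spaces.linear "fun_scale (*) :: 'k \<Rightarrow> (('c \<Rightarrow> 'c \<Rightarrow> 'k) \<Rightarrow> 'k) \<Rightarrow> _"
          "fun_scale (*)" "tensor sV (fun_scale (*)) l"
        using bilinear_tensor[OF vs(2) vsT] by (simp add: bilinear_map_def)
      show ?thesis by (rule l.sum)
    qed
    then show ?thesis by (subst sum.swap) (simp only:)
  qed
  finally have "tensor_lift sV (fun_scale (*)) ?p
      (\<Sum>l\<in>B. tensor sV (fun_scale (*)) l (\<Sum>i\<in>B. tensor sC sC (coef l i) (coef i j)))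
    = tensor_lift sV (fun_scale (*)) ?p (\<Sum>i\<in>B. tensor sV (fun_scale (*)) i (\<Delta> (coef i j)))"
    by (rule arg_cong)
  then show ?thesis by (simp only: L)
qed

text \<open>Read off from the \<open>i\<close>-th coordinate of the counit axiom at the basis vector
  \<open>j\<close>.\<close>

lemma counit_coef:
  assumes "i \<in> B" "j \<in> B"
  shows "\<epsilon> (coef i j) = (if i = j then 1 else 0)"
proof -
  have b: "bilinear_map sV sC sV (\<lambda>x c. sV (\<epsilon> c) x)"
    using counit_linear[unfolded Vector_Spaces.linear_iff]
    by (intro bilinear_mapI vs) (simp_all add: V.scale_left_distrib V.scale_right_distrib mult.commute)
  interpret L: Vector_Spaces.linear sV "(*)" "coord i" by (rule linear_coord)
  have "coord i j = coord i (\<Sum>l\<in>B. sV (\<epsilon> (coef l j)) l)"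
    using coaction_counit[of j] by (simp add: tensor_lift_coaction[OF b])
  also have "\<dots> = (\<Sum>l\<in>B. \<epsilon> (coef l j) * (if i = l then 1 else 0))"
    by (simp add: L.sum coord_basis)
  also have "\<dots> = \<epsilon> (coef i j)"
    using assms finite_B by (simp add: if_distrib[of "\<lambda>x. _ * x"] cong: if_cong)
  finally show ?thesis using assms by (simp add: coord_basis)
qed

text \<open>The bridge from Sweedler notation to finite matrix sums: identities for \<gamma>,
  \<open>S\<close> and \<lambda> are evaluated on coefficients through it.\<close>

lemma sweedler2_coef:
  assumes "bilinear_map sC sC sU b" "i \<in> B"
  shows "sweedler2 sC \<Delta> b (coef i j) = (\<Sum>k\<in>B. b (coef i k) (coef k j))"
  unfolding sweedler2_def comult_coef[OF assms(2)] by (rule tensor_lift_sum_set[OF assms(1) finite_B])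

end

section \<open>Iterated Sweedler sums\<close>

lemma (in coalgebra) linear_sweedler2:
  assumes "bilinear_map sC sC sU b"
  shows "Vector_Spaces.linear sC sU (sweedler2 sC \<Delta> b)"
  unfolding sweedler2_def using linear_tensor_lift[OF assms comult_linear comult_mem] .

text \<open>Together the hypotheses say that \<open>b\<close> is trilinear. The conclusion lets the
  inner sum of \<open>sweedler3\<close> serve as the bilinear map of the outer one.\<close>

lemma (in coalgebra) bilinear_sweedler2:
  assumes "\<And>x. bilinear_map sC sC sU (b x)"
    and "\<And>x x' y z. b (x + x') y z = b x y z + b x' y z"
    and "\<And>a x y z. b (sC a x) y z = sU a (b x y z)"
  shows "bilinear_map sC sC sU (\<lambda>x. sweedler2 sC \<Delta> (b x))"
proof -
  have U: "vector_space sU" "vector_space sC"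
    using assms(1) by (auto simp: bilinear_map_def Vector_Spaces.linear_iff)
  have "b (x + x') = (\<lambda>y z. b x y z + b x' y z)" "b (sC a x) = (\<lambda>y z. sU a (b x y z))" for a x x'
    by (simp_all add: fun_eq_iff assms(2,3))
  then show ?thesis
    using linear_sweedler2[OF assms(1), unfolded Vector_Spaces.linear_iff] U
    by (intro bilinear_mapI)
      (simp_all add: sweedler2_def tensor_lift_add_fun tensor_lift_scale_fun[OF U(1)])
qed

context comodule_with_basis
begin

lemma sweedler3_coef:
  assumes b: "\<And>x. bilinear_map sC sC sU (b x)"
    and "\<And>x x' y z. b (x + x') y z = b x y z + b x' y z"
    and "\<And>a x y z. b (sC a x) y z = sU a (b x y z)"
    and "i \<in> B"
  shows "sweedler3 sC \<Delta> b (coef i j) = (\<Sum>k\<in>B. \<Sum>l\<in>B. b (coef i k) (coef k l) (coef l j))"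
  unfolding sweedler3_def sweedler2_coef[OF bilinear_sweedler2[of sU b, OF assms(1-3)] assms(4)]
  using sweedler2_coef[OF b] by simp

section \<open>Comodule maps into the dual as bilinear forms\<close>

text \<open>The equation is the comodule condition at \<open>i\<close>, evaluated at
  \<open>j\<close>: the sum with \<open>S\<close> comes from the dual coaction, the other from
  applying \<open>f\<close> to the first factor of \<rho>. Both are bilinear in the two vectors, so
  basis vectors suffice.\<close>

lemma comodule_homs_dual_iff:
  assumes S: "Vector_Spaces.linear sC sC S"
  shows "f \<in> comodule_homs sC sV \<rho> (fun_scale (*)) (dual_space sV) (dual_coaction sC S sV \<rho>) \<longleftrightarrow>
    bilinear_map sV sV (*) f \<and>
    (\<forall>i\<in>B. \<forall>j\<in>B. (\<Sum>k\<in>B. sC (f i k) (S (coef k j))) = (\<Sum>k\<in>B. sC (f k j) (coef k i)))"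
proof (cases "bilinear_map sV sV (*) f")
  \<comment> \<open>A comodule map is linear with linear functionals as values, hence bilinear, so
    both sides fail here.\<close>
  case False
  have "Vector_Spaces.linear sV (*) (\<lambda>v. f v w)" if "Vector_Spaces.linear sV (fun_scale (*)) f" for w
    using that by (auto simp: Vector_Spaces.linear_iff fun_scale_def vector_space_mult)
  with False show ?thesis
    by (auto simp: comodule_homs_def dual_space_def bilinear_map_def)
next
  case True
  let ?sD = "fun_scale (*) :: 'k \<Rightarrow> ('v \<Rightarrow> 'k) \<Rightarrow> _"
  have sD: "vector_space ?sD" by (rule vector_space_tensor)
  interpret D: vector_space ?sD by (rule sD)
  note fl = True[unfolded bilinear_map_def Vector_Spaces.linear_iff]
  note Sl = S[unfolded Vector_Spaces.linear_iff]
  have flin: "Vector_Spaces.linear sV ?sD f"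
    using fl sD by (auto simp: Vector_Spaces.linear_iff fun_scale_def fun_eq_iff)
  have fD: "f v \<in> dual_space sV" for v
    using True by (simp add: dual_space_def bilinear_map_def)
  have sub: "D.subspace (dual_space sV)"
    using vs vector_space_mult
    by (auto simp: D.subspace_def dual_space_def Vector_Spaces.linear_iff fun_scale_def algebra_simps)
  \<comment> \<open>\<open>t v\<close> is \<open>f\<close> applied to the first factor of
    \<open>\<rho> v\<close>, which the coaction of \<open>f v\<close> has to equal.\<close>
  define t where "t v = tensor_lift sV sC (\<lambda>x c. tensor ?sD sC (f x) c) (\<rho> v)" for v
  note tD = bilinear_tensor[OF sD vs(1), unfolded bilinear_map_def Vector_Spaces.linear_iff]
  have tb: "bilinear_map sV sC (fun_scale (*)) (\<lambda>x c. tensor ?sD sC (f x) c)"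
    using tD flin[unfolded Vector_Spaces.linear_iff] by (intro bilinear_mapI vs vector_space_tensor) auto
  have evb: "bilinear_map ?sD sC sC (\<lambda>g c. sC (g u) c)" for u
    by (intro bilinear_mapI vs sD)
      (simp_all add: scale_right_distrib scale_left_distrib mult.commute fun_scale_def)
  have Lb: "bilinear_map sV sC sC (\<lambda>x c. sC (f x u) c)" for u
    using fl by (intro bilinear_mapI vs) (simp_all add: scale_right_distrib scale_left_distrib mult.commute)
  have Rb: "bilinear_map sV sC sC (\<lambda>x c. sC (f v x) (S c))" for v
    using fl Sl by (intro bilinear_mapI vs) (simp_all add: scale_right_distrib scale_left_distrib mult.commute)
  \<comment> \<open>\<open>L v u\<close> and \<open>R v u\<close> are \<open>t v\<close> and the
    dual coaction of \<open>f v\<close>, each evaluated at \<open>u\<close> in the first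
    factor.\<close>
  define L where "L v u = tensor_lift sV sC (\<lambda>x c. sC (f x u) c) (\<rho> v)" for v u
  define R where "R v u = tensor_lift sV sC (\<lambda>x c. sC (f v x) (S c)) (\<rho> u)" for v u
  have t_mem: "t v \<in> tensor_space ?sD sC (dual_space sV) UNIV"
    and t_ev: "tensor_lift ?sD sC (\<lambda>g c. sC (g u) c) (t v) = L v u" for v u
  proof -
    obtain xs where xs: "\<rho> v = (\<Sum>(x, c)\<leftarrow>xs. tensor sV sC x c)"
      using coaction_mem[of v] tensor_space_UNIV_iff[OF vs(2,1)] by blast
    let ?ys = "map (\<lambda>(x, c). (f x, c)) xs"
    have t: "t v = (\<Sum>(g, c)\<leftarrow>?ys. tensor ?sD sC g c)"
      unfolding t_def xs tensor_lift_sum[OF tb] by (simp add: o_def case_prod_unfold)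
    show "t v \<in> tensor_space ?sD sC (dual_space sV) UNIV"
      unfolding tensor_space_iff[OF sD vs(1) sub] using t fD by (intro exI[of _ ?ys]) auto
    show "tensor_lift ?sD sC (\<lambda>g c. sC (g u) c) (t v) = L v u"
      unfolding t tensor_lift_sum[OF evb] L_def xs tensor_lift_sum[OF Lb] by (simp add: o_def case_prod_unfold)
  qed
  have dual: "dual_coaction sC S sV \<rho> (f v) = t v \<longleftrightarrow> (\<forall>u. L v u = R v u)" for v
  proof -
    \<comment> \<open>The dual coaction is a definite description; by
      \<open>dual_coaction_ex1\<close>, being equal to it amounts to having its defining
      property.\<close>
    have the_iff: "(THE x. Q x) = y \<longleftrightarrow> Q y" if "\<exists>!x. Q x" for Q and y :: "(('v \<Rightarrow> 'k) \<Rightarrow> 'c \<Rightarrow> 'k) \<Rightarrow> 'k"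
      using theI'[OF that] the1_equality[OF that] by metis
    have "dual_coaction sC S sV \<rho> (f v) = t v \<longleftrightarrow>
      t v \<in> tensor_space ?sD sC (dual_space sV) UNIV \<and>
        (\<forall>u. tensor_lift ?sD sC (\<lambda>g c. sC (g u) c) (t v) = R v u)"
      unfolding dual_coaction_def R_def
      by (rule the_iff[OF dual_coaction_ex1[OF S fD finite_B indep_B span_B]])
    then show ?thesis by (simp add: t_mem t_ev)
  qed
  have L1: "Vector_Spaces.linear sV sC (\<lambda>v. L v u)" for u
    unfolding L_def by (rule linear_tensor_lift[OF Lb coaction_linear coaction_mem])
  have R2: "Vector_Spaces.linear sV sC (R v)" for v
    unfolding R_def by (rule linear_tensor_lift[OF Rb coaction_linear coaction_mem])
  \<comment> \<open>Here the variable sits in the map being lifted and not in the tensor; the same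
    holds for \<open>R1\<close>.\<close>
  have L2: "Vector_Spaces.linear sV sC (L v)" for v
    unfolding Vector_Spaces.linear_iff
  proof (intro conjI allI vs)
    show "L v (u + u') = L v u + L v u'" for u u'
      using fl by (simp add: L_def scale_left_distrib tensor_lift_add_fun)
    have "(\<lambda>x c. sC (f x (sV a u)) c) = (\<lambda>x c. sC a (sC (f x u) c))" for a u
      using fl by simp
    then show "L v (sV a u) = sC a (L v u)" for a u
      by (simp only: L_def tensor_lift_scale_fun[OF vs(1)])
  qed
  have R1: "Vector_Spaces.linear sV sC (\<lambda>v. R v u)" for u
    unfolding Vector_Spaces.linear_iff
  proof (intro conjI allI vs)
    show "R (v + v') u = R v u + R v' u" for v v'
      using fl by (simp add: R_def scale_left_distrib tensor_lift_add_fun)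
    have "(\<lambda>x c. sC (f (sV a v) x) (S c)) = (\<lambda>x c. sC a (sC (f v x) (S c)))" for a v
      using fl by simp
    then show "R (sV a v) u = sC a (R v u)" for a v
      by (simp only: R_def tensor_lift_scale_fun[OF vs(1)])
  qed
  have basis_iff: "(\<forall>v u. L v u = R v u) \<longleftrightarrow> (\<forall>i\<in>B. \<forall>j\<in>B. L i j = R i j)"
  proof
    assume eq: "\<forall>i\<in>B. \<forall>j\<in>B. L i j = R i j"
    show "\<forall>v u. L v u = R v u"
    proof (intro allI)
      fix v u
      have "L i u = R i u" if "i \<in> B" for i
        unfolding linear_eq_sum_coord[OF L2, of i u] linear_eq_sum_coord[OF R2, of i u]
        using eq that by simp
      then show "L v u = R v u"
        unfolding linear_eq_sum_coord[OF L1, of v u] linear_eq_sum_coord[OF R1, of v u] by simp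
    qed
  qed simp
  have L_basis: "L i j = (\<Sum>k\<in>B. sC (f k j) (coef k i))"
    and R_basis: "R i j = (\<Sum>k\<in>B. sC (f i k) (S (coef k j)))"
    for i j
    by (simp_all add: L_def R_def tensor_lift_coaction[OF Lb] tensor_lift_coaction[OF Rb])
  have "range f \<subseteq> dual_space sV"
    using fD by blast
  then have "f \<in> comodule_homs sC sV \<rho> ?sD (dual_space sV) (dual_coaction sC S sV \<rho>) \<longleftrightarrow>
      (\<forall>v. dual_coaction sC S sV \<rho> (f v) = t v)"
    unfolding comodule_homs_def t_def using flin by simp
  also have "\<dots> \<longleftrightarrow> (\<forall>i\<in>B. \<forall>j\<in>B. R i j = L i j)"
    unfolding dual basis_iff by (simp only: eq_commute)
  finally show ?thesis
    using True by (simp only: L_basis R_basis simp_thms)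
qed

end

section \<open>The copivotal structure in coefficients\<close>

locale coseparable_copivotal_comodule =
  copivotal_coalgebra sC \<Delta> \<epsilon> S \<gamma> \<gamma>bar + comodule_with_basis sC \<Delta> \<epsilon> sV \<rho> B
  for sC :: "'k::field \<Rightarrow> 'c::ab_group_add \<Rightarrow> 'c"
    and \<Delta> :: "'c \<Rightarrow> ('c \<Rightarrow> 'c \<Rightarrow> 'k) \<Rightarrow> 'k"
    and \<epsilon> :: "'c \<Rightarrow> 'k"
    and S :: "'c \<Rightarrow> 'c"
    and \<gamma> \<gamma>bar :: "'c \<Rightarrow> 'k"
    and sV :: "'k \<Rightarrow> 'v::ab_group_add \<Rightarrow> 'v"
    and \<rho> :: "'v \<Rightarrow> ('v \<Rightarrow> 'c \<Rightarrow> 'k) \<Rightarrow> 'k"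
    and B :: "'v set" +
  fixes lam :: "'c \<Rightarrow> 'c \<Rightarrow> 'k"
  assumes coseparable: "coseparability_idempotent sC \<Delta> \<epsilon> lam"
begin

abbreviation "homs \<equiv> comodule_homs sC sV \<rho> (fun_scale (*)) (dual_space sV) (dual_coaction sC S sV \<rho>)"
abbreviation "form_scale \<equiv> fun_scale (fun_scale (*)) :: 'k \<Rightarrow> ('v \<Rightarrow> 'v \<Rightarrow> 'k) \<Rightarrow> _"
abbreviation "act \<equiv> dual_action sC sV \<rho> \<gamma>"

sublocale S: Vector_Spaces.linear sC sC S
  by (rule S_linear)

lemma homs_iff:
  "f \<in> homs \<longleftrightarrow> bilinear_map sV sV (*) f \<and>
    (\<forall>i\<in>B. \<forall>j\<in>B. (\<Sum>k\<in>B. sC (f i k) (S (coef k j))) = (\<Sum>k\<in>B. sC (f k j) (coef k i)))"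
  by (rule comodule_homs_dual_iff[OF S_linear])

lemma lam_bilinear: "bilinear_map sC sC (*) lam"
  using coseparable by (simp add: coseparability_idempotent_def)

lemma lam_simps [simp]:
  "lam (x + x') y = lam x y + lam x' y" "lam (sC a x) y = a * lam x y"
  "lam x (y + y') = lam x y + lam x y'" "lam x (sC a y) = a * lam x y"
  using lam_bilinear by (auto simp: bilinear_map_def Vector_Spaces.linear_iff)

lemma lam_sum_left: "lam (\<Sum>i\<in>I. h i) y = (\<Sum>i\<in>I. lam (h i) y)"
proof -
  interpret L: Vector_Spaces.linear sC "(*)" "\<lambda>x. lam x y"
    using lam_bilinear by (simp add: bilinear_map_def)
  show ?thesis by (rule L.sum)
qed

lemma gamma_simps [simp]:
  "\<gamma> (x + y) = \<gamma> x + \<gamma> y" "\<gamma> (sC a x) = a * \<gamma> x"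
  "\<gamma>bar (x + y) = \<gamma>bar x + \<gamma>bar y" "\<gamma>bar (sC a x) = a * \<gamma>bar x"
  using gamma_linear gammabar_linear by (auto simp: Vector_Spaces.linear_iff)

text \<open>Convolution of functionals becomes multiplication of their matrices on the coefficients,
  so the matrices of \<open>\<gamma>bar\<close> and \<gamma> are inverse to each other.\<close>

lemma gammabar_gamma_coef:
  assumes "i \<in> B" "j \<in> B"
  shows "(\<Sum>k\<in>B. \<gamma>bar (coef i k) * \<gamma> (coef k j)) = (if i = j then 1 else 0)"
proof -
  have "bilinear_map sC sC (*) (\<lambda>x y. \<gamma>bar x * \<gamma> y)"
    by (intro bilinear_mapI vs vector_space_mult) (simp_all add: algebra_simps)
  then have "convolution sC \<Delta> \<gamma>bar \<gamma> (coef i j) = (\<Sum>k\<in>B. \<gamma>bar (coef i k) * \<gamma> (coef k j))"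
    unfolding convolution_def using assms(1) by (rule sweedler2_coef)
  then show ?thesis
    using counit_coef[OF assms] by (simp add: gammabar_conv_gamma)
qed

lemma S_squared_coef:
  assumes "i \<in> B"
  shows "S (S (coef i j)) = (\<Sum>k\<in>B. \<Sum>l\<in>B. sC (\<gamma> (coef i k) * \<gamma>bar (coef l j)) (coef k l))"
  unfolding S_squared using assms
  by (intro sweedler3_coef[where sU = sC] bilinear_mapI vs)
    (simp_all add: scale_left_distrib scale_right_distrib distrib_left distrib_right mult.assoc mult.left_commute)

text \<open>Multiplying the formula for the square of \<open>S\<close> on the right by the matrix of
  \<gamma> cancels \<open>\<gamma>bar\<close>. In this form the copivotal axiom enters the
  invariance of the space of comodule maps.\<close>

lemma S_squared_gamma_coef:
  assumes "i \<in> B" "j \<in> B"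
  shows "(\<Sum>k\<in>B. sC (\<gamma> (coef k j)) (S (S (coef i k)))) = (\<Sum>k\<in>B. sC (\<gamma> (coef i k)) (coef k j))"
proof -
  have "(\<Sum>k\<in>B. sC (\<gamma> (coef k j)) (S (S (coef i k))))
      = (\<Sum>p\<in>B. \<Sum>k\<in>B. \<Sum>l\<in>B. sC (\<gamma> (coef i k) * (\<gamma>bar (coef l p) * \<gamma> (coef p j))) (coef k l))"
    by (simp add: S_squared_coef[OF assms(1)] scale_sum_right mult_ac)
  also have "\<dots> = (\<Sum>k\<in>B. \<Sum>p\<in>B. \<Sum>l\<in>B. sC (\<gamma> (coef i k) * (\<gamma>bar (coef l p) * \<gamma> (coef p j))) (coef k l))"
    by (rule sum.swap)
  also have "\<dots> = (\<Sum>k\<in>B. \<Sum>l\<in>B. \<Sum>p\<in>B. sC (\<gamma> (coef i k) * (\<gamma>bar (coef l p) * \<gamma> (coef p j))) (coef k l))"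
    by (rule sum.cong[OF refl], rule sum.swap)
  \<comment> \<open>The sum over \<open>p\<close> is a product of inverse matrices, which leaves
    only \<open>l = j\<close>.\<close>
  also have "\<dots> = (\<Sum>k\<in>B. \<Sum>l\<in>B. sC (\<gamma> (coef i k) * (if l = j then 1 else 0)) (coef k l))"
    by (intro sum.cong refl)
      (simp only: scale_sum_left[symmetric] sum_distrib_left[symmetric] gammabar_gamma_coef[OF _ assms(2)])
  also have "\<dots> = (\<Sum>k\<in>B. \<Sum>l\<in>B. if l = j then sC (\<gamma> (coef i k)) (coef k l) else 0)"
    by (intro sum.cong refl) simp
  also have "\<dots> = (\<Sum>k\<in>B. sC (\<gamma> (coef i k)) (coef k j))"
    using assms(2) finite_B by simp
  finally show ?thesis .
qed

text \<open>Since \<open>S\<close> reverses comultiplication, the factor carrying the column index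
  \<open>j\<close> comes first.\<close>

lemma sweedler2_S_coef:
  assumes b: "bilinear_map sC sC sU b" and i: "i \<in> B"
  shows "sweedler2 sC \<Delta> b (S (coef i j)) = (\<Sum>k\<in>B. b (S (coef k j)) (S (coef i k)))"
proof -
  have t: "bilinear_map sC sC (fun_scale (*)) (\<lambda>x y. tensor sC sC (S y) (S x))"
    using bilinear_tensor[OF vs(1,1), unfolded bilinear_map_def Vector_Spaces.linear_iff]
    by (intro bilinear_mapI vs vector_space_tensor) (simp_all add: S.add S.scale)
  show ?thesis
    unfolding sweedler2_def S_comult sweedler2_coef[OF t i, unfolded sweedler2_def]
    by (rule tensor_lift_sum_set[OF b finite_B])
qed

lemma act_basis: "act i = (\<Sum>k\<in>B. sV (\<gamma> (coef k i)) k)"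
  unfolding dual_action_def
  by (rule tensor_lift_coaction[where sU = sV], intro bilinear_mapI vs)
    (simp_all add: V.scale_left_distrib V.scale_right_distrib mult.commute)

lemma linear_act: "Vector_Spaces.linear sV sV act"
  unfolding dual_action_def
  by (rule linear_tensor_lift[OF _ coaction_linear coaction_mem], intro bilinear_mapI vs)
    (simp_all add: V.scale_left_distrib V.scale_right_distrib mult.commute)

section \<open>The frame of comodule maps given by \<lambda>\<close>

text \<open>The image of the elementary form with entry \<open>1\<close> at \<open>(l, m)\<close> under the projection defined by \<open>\<lambda>\<close>.\<close>

definition frame where
  "frame l m v u = (\<Sum>j\<in>B. \<Sum>k\<in>B. coord j v * coord k u * lam (S (coef m k)) (coef l j))"

lemma bilinear_frame: "bilinear_map sV sV (*) (frame l m)"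
  by (intro bilinear_mapI vs vector_space_mult)
    (simp_all add: frame_def algebra_simps sum.distrib sum_distrib_left)

lemma bilinear_form_expand:
  assumes "bilinear_map sV sV (*) f"
  shows "f v u = (\<Sum>j\<in>B. \<Sum>k\<in>B. coord j v * coord k u * f j k)"
proof -
  have l: "Vector_Spaces.linear sV (*) (\<lambda>v. f v u)" "Vector_Spaces.linear sV (*) (f j)" for j
    using assms by (auto simp: bilinear_map_def)
  show ?thesis
    unfolding linear_eq_sum_coord[OF l(1), of v]
    by (intro sum.cong refl, subst linear_eq_sum_coord[OF l(2)]) (simp add: sum_distrib_left mult.assoc)
qed

lemma frame_basis:
  assumes "j \<in> B" "k \<in> B"
  shows "frame l m j k = lam (S (coef m k)) (coef l j)"
proof -
  have "frame l m j k = (\<Sum>j'\<in>B. \<Sum>k'\<in>B. if j' = j then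
      (if k' = k then lam (S (coef m k')) (coef l j') else 0) else 0)"
    unfolding frame_def using assms by (intro sum.cong refl) (simp add: coord_basis)
  also have "\<dots> = (\<Sum>j'\<in>B. if j' = j then (\<Sum>k'\<in>B. if k' = k then lam (S (coef m k')) (coef l j') else 0) else 0)"
    by (intro sum.cong refl) simp
  also have "\<dots> = lam (S (coef m k)) (coef l j)"
    using assms finite_B by simp
  finally show ?thesis .
qed

text \<open>With \<open>c = S (coef m j)\<close> and \<open>d = coef l i\<close>, the identity
  \<open>c\<^sub>1 \<lambda>(c\<^sub>2, d) = \<lambda>(c, d\<^sub>1) d\<^sub>2\<close> is exactly
  the comodule condition at \<open>(i, j)\<close>.\<close>

lemma frame_mem:
  assumes "l \<in> B" "m \<in> B"
  shows "frame l m \<in> homs"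
  unfolding homs_iff
proof (intro conjI ballI bilinear_frame)
  fix i j assume ij: "i \<in> B" "j \<in> B"
  let ?c = "S (coef m j)" and ?d = "coef l i"
  have "(\<Sum>k\<in>B. sC (frame l m i k) (S (coef k j))) = sweedler2 sC \<Delta> (\<lambda>c1 c2. sC (lam c2 ?d) c1) ?c"
    using ij assms
    by (subst sweedler2_S_coef[where sU = sC])
      (auto simp: frame_basis scale_left_distrib scale_right_distrib mult.commute intro!: bilinear_mapI vs)
  also have "\<dots> = sweedler2 sC \<Delta> (\<lambda>d1 d2. sC (lam ?c d1) d2) ?d"
    using coseparable by (simp add: coseparability_idempotent_def)
  also have "\<dots> = (\<Sum>k\<in>B. sC (frame l m k j) (coef k i))"
    using ij assms
    by (subst sweedler2_coef[where sU = sC])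
      (auto simp: frame_basis scale_left_distrib scale_right_distrib mult.commute intro!: bilinear_mapI vs)
  finally show "(\<Sum>k\<in>B. sC (frame l m i k) (S (coef k j))) = (\<Sum>k\<in>B. sC (frame l m k j) (coef k i))" .
qed

text \<open>The projection fixes comodule maps: their defining condition trades \<open>S\<close> for
  plain coefficients inside \<lambda>, after which
  \<open>\<lambda>(c\<^sub>1, c\<^sub>2) = \<epsilon>(c)\<close> collapses the sum.\<close>

lemma homs_eq_sum_frame:
  assumes f: "f \<in> homs"
  shows "f = (\<Sum>(l, m)\<in>B \<times> B. form_scale (f l m) (frame l m))"
proof (intro ext)
  fix v u
  note f' = f[unfolded homs_iff]
  have basis: "f j k = (\<Sum>l\<in>B. \<Sum>m\<in>B. f l m * frame l m j k)" if jk: "j \<in> B" "k \<in> B" for j k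
  proof -
    have "(\<Sum>l\<in>B. \<Sum>m\<in>B. f l m * frame l m j k)
        = (\<Sum>l\<in>B. lam (\<Sum>m\<in>B. sC (f l m) (S (coef m k))) (coef l j))"
      using jk by (simp add: frame_basis lam_sum_left)
    \<comment> \<open>This is the comodule condition at \<open>(l, k)\<close>, which removes
      \<open>S\<close>.\<close>
    also have "\<dots> = (\<Sum>l\<in>B. lam (\<Sum>p\<in>B. sC (f p k) (coef p l)) (coef l j))"
      using f' jk by simp
    also have "\<dots> = (\<Sum>p\<in>B. f p k * (\<Sum>l\<in>B. lam (coef p l) (coef l j)))"
      by (simp add: lam_sum_left sum_distrib_left) (rule sum.swap)
    \<comment> \<open>The sum over \<open>l\<close> is \<lambda> on the comultiplication of
      \<open>coef p j\<close>.\<close>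
    also have "\<dots> = (\<Sum>p\<in>B. f p k * \<epsilon> (coef p j))"
      using coseparable
      by (intro sum.cong refl)
        (simp add: sweedler2_coef[OF lam_bilinear, symmetric] coseparability_idempotent_def)
    also have "\<dots> = (\<Sum>p\<in>B. if p = j then f p k else 0)"
      using jk by (intro sum.cong refl) (simp add: counit_coef)
    also have "\<dots> = f j k"
      using jk finite_B by simp
    finally show ?thesis by simp
  qed
  \<comment> \<open>Both forms are bilinear, so agreement on basis vectors extends through
    \<open>bilinear_form_expand\<close>.\<close>
  have "bilinear_map sV sV (*) (\<lambda>v u. \<Sum>l\<in>B. \<Sum>m\<in>B. f l m * frame l m v u)"
    using bilinear_frame
    by (intro bilinear_mapI vs vector_space_mult)
      (simp_all add: bilinear_map_def Vector_Spaces.linear_iff algebra_simps sum.distrib sum_distrib_left)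
  note expand = bilinear_form_expand[OF this, of v u]
  have "f v u = (\<Sum>j\<in>B. \<Sum>k\<in>B. coord j v * coord k u * f j k)"
    by (rule bilinear_form_expand[OF conjunct1[OF f']])
  also have "\<dots> = (\<Sum>j\<in>B. \<Sum>k\<in>B. coord j v * coord k u * (\<Sum>l\<in>B. \<Sum>m\<in>B. f l m * frame l m j k))"
    by (intro sum.cong refl arg_cong[where f = "(*) _"] basis)
  also have "\<dots> = (\<Sum>l\<in>B. \<Sum>m\<in>B. f l m * frame l m v u)"
    by (rule expand[symmetric])
  finally have "f v u = (\<Sum>l\<in>B. \<Sum>m\<in>B. f l m * frame l m v u)" .
  then show "f v u = (\<Sum>(l, m)\<in>B \<times> B. form_scale (f l m) (frame l m)) v u"
    by (simp add: sum_fun_app case_prod_unfold fun_scale_def sum.cartesian_product)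
qed

section \<open>The twisted endomorphism and its trace\<close>

text \<open>Swapping the arguments of \<open>f\<close> puts its comodule condition under a further
  \<open>S\<close>; the resulting \<open>S (S c)\<close> is absorbed by the factor \<gamma> coming
  from \<open>act\<close>, via \<open>S_squared_gamma_coef\<close>.\<close>

lemma twist_mem:
  assumes f: "f \<in> homs"
  shows "(\<lambda>v w. f w (act v)) \<in> homs"
proof -
  note f' = f[unfolded homs_iff]
  note fl = conjunct1[OF f', unfolded bilinear_map_def]
  have f_act: "f j (act i) = (\<Sum>k\<in>B. \<gamma> (coef k i) * f j k)" for i j
  proof -
    interpret L: Vector_Spaces.linear sV "(*)" "f j" using fl by simp
    show ?thesis by (simp add: act_basis L.sum L.scale)
  qed
  have "bilinear_map sV sV (*) (\<lambda>v w. f w (act v))"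
    using fl linear_act by (simp add: bilinear_map_def Vector_Spaces.linear_iff)
  moreover have "(\<Sum>k\<in>B. sC (f k (act i)) (S (coef k j))) = (\<Sum>k\<in>B. sC (f j (act k)) (coef k i))"
    if ij: "i \<in> B" "j \<in> B" for i j
  proof -
    have "(\<Sum>k\<in>B. sC (f k (act i)) (S (coef k j)))
        = (\<Sum>k\<in>B. \<Sum>p\<in>B. sC (\<gamma> (coef p i)) (sC (f k p) (S (coef k j))))"
      by (simp add: f_act scale_sum_left)
    also have "\<dots> = (\<Sum>p\<in>B. sC (\<gamma> (coef p i)) (S (\<Sum>k\<in>B. sC (f k p) (coef k j))))"
      by (subst sum.swap) (simp add: S.sum S.scale scale_sum_right)
    \<comment> \<open>The comodule condition for \<open>f\<close> at \<open>(j, p)\<close>, used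
      under \<open>S\<close>.\<close>
    also have "\<dots> = (\<Sum>p\<in>B. sC (\<gamma> (coef p i)) (S (\<Sum>q\<in>B. sC (f j q) (S (coef q p)))))"
      using f' ij by simp
    also have "\<dots> = (\<Sum>p\<in>B. \<Sum>q\<in>B. sC (f j q) (sC (\<gamma> (coef p i)) (S (S (coef q p)))))"
      by (simp add: S.sum S.scale scale_sum_right mult.commute)
    also have "\<dots> = (\<Sum>q\<in>B. sC (f j q) (\<Sum>p\<in>B. sC (\<gamma> (coef p i)) (S (S (coef q p)))))"
      by (subst sum.swap) (simp add: scale_sum_right)
    also have "\<dots> = (\<Sum>q\<in>B. sC (f j q) (\<Sum>k\<in>B. sC (\<gamma> (coef q k)) (coef k i)))"
      using ij by (simp add: S_squared_gamma_coef)
    also have "\<dots> = (\<Sum>q\<in>B. \<Sum>k\<in>B. sC (\<gamma> (coef q k) * f j q) (coef k i))"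
      by (simp add: scale_sum_right mult.commute)
    also have "\<dots> = (\<Sum>k\<in>B. sC (f j (act k)) (coef k i))"
      by (subst sum.swap) (simp add: f_act scale_sum_left)
    finally show ?thesis .
  qed
  ultimately show ?thesis by (simp add: homs_iff)
qed

lemma vector_space_forms: "vector_space form_scale"
  by (intro vector_space_fun_scale vector_space_mult)

lemma subspace_homs: "module.subspace form_scale homs"
proof -
  interpret F: vector_space form_scale by (rule vector_space_forms)
  have "x + y \<in> homs" if "x \<in> homs" "y \<in> homs" for x y
    using that
    by (auto simp: homs_iff bilinear_map_def Vector_Spaces.linear_iff algebra_simps
        scale_left_distrib sum.distrib)
  moreover have "form_scale a x \<in> homs" if "x \<in> homs" for a x
    using that
    by (auto simp: homs_iff bilinear_map_def Vector_Spaces.linear_iff fun_scale_def algebra_simps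
        simp flip: scale_scale scale_sum_right)
  moreover have "0 \<in> homs"
    by (simp add: homs_iff bilinear_map_def Vector_Spaces.linear_iff vs vector_space_mult)
  ultimately show ?thesis by (simp add: F.subspace_def)
qed

text \<open>The trace is the sum over \<open>(l, m)\<close> of the entry at \<open>(l, m)\<close> of
  the twisted form \<open>frame l m\<close>, which is \<open>frame l m m (act l)\<close>; the sum
  over \<open>k\<close> expands \<open>act l\<close>.\<close>

lemma fs_indicator_eq_sum:
  "fs_indicator sC S \<gamma> sV \<rho> =
    (\<Sum>l\<in>B. \<Sum>m\<in>B. \<Sum>k\<in>B. lam (S (coef m k)) (coef l m) * \<gamma> (coef k l))"
proof -
  let ?T = "\<lambda>f v w. f w (act v)"
  have lin: "Vector_Spaces.linear form_scale (*) (\<lambda>f. f v w)" for v w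
    using vector_space_forms vector_space_mult
    by (simp add: Vector_Spaces.linear_iff fun_scale_def)
  have T: "Vector_Spaces.linear form_scale form_scale ?T"
    using vector_space_forms by (simp add: Vector_Spaces.linear_iff fun_scale_def fun_eq_iff)
  \<comment> \<open>With \<open>f\<close> read as a form, the transpose composed with the bidual map
    unfolds to \<open>f w (act v)\<close>.\<close>
  have "fs_indicator sC S \<gamma> sV \<rho> = trace_on form_scale homs ?T"
    by (simp add: fs_indicator_def transpose_map_def canonical_bidual_map_def comp_def)
  also have "\<dots> = (\<Sum>x\<in>B \<times> B. ?T (frame (fst x) (snd x)) (fst x) (snd x))"
  \<comment> \<open>Functionals and vectors are both indexed by pairs \<open>(l, m)\<close>: the
    entry at that pair and the form \<open>frame l m\<close>.\<close>
  proof (rule trace_on_frame[where \<phi> = "\<lambda>x f. f (fst x) (snd x)" and w = "\<lambda>x. frame (fst x) (snd x)",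
        OF vector_space_forms subspace_homs _ _ lin _ T twist_mem])
    fix u assume "u \<in> homs"
    from homs_eq_sum_frame[OF this]
    show "u = (\<Sum>x\<in>B \<times> B. form_scale (u (fst x) (snd x)) (frame (fst x) (snd x)))"
      by (simp only: case_prod_unfold)
  qed (auto simp: finite_B frame_mem)
  also have "\<dots> = (\<Sum>l\<in>B. \<Sum>m\<in>B. frame l m m (act l))"
    by (simp add: sum.cartesian_product case_prod_unfold)
  also have "\<dots> = (\<Sum>l\<in>B. \<Sum>m\<in>B. \<Sum>k\<in>B. lam (S (coef m k)) (coef l m) * \<gamma> (coef k l))"
  proof (intro sum.cong refl)
    fix l m assume "l \<in> B" "m \<in> B"
    interpret L: Vector_Spaces.linear sV "(*)" "frame l m m"
      using bilinear_frame by (simp add: bilinear_map_def)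
    show "frame l m m (act l) = (\<Sum>k\<in>B. lam (S (coef m k)) (coef l m) * \<gamma> (coef k l))"
      using \<open>m \<in> B\<close> by (simp add: act_basis L.sum L.scale frame_basis mult.commute)
  qed
  finally show ?thesis .
qed

section \<open>Evaluation at the character\<close>

text \<open>Comultiplying a diagonal coefficient \<open>coef m m\<close> twice gives
  \<open>coef m k\<close>, \<open>coef k l\<close> and \<open>coef l m\<close> for
  \<open>t1\<close>, \<open>t2\<close> and \<open>t3\<close>; reordering the sums yields the trace
  formula.\<close>

lemma sweedler3_character:
  "sweedler3 sC \<Delta> (\<lambda>t1 t2 t3. lam (S t1) t3 * \<gamma> t2) (character sC sV \<rho> B) =
    (\<Sum>l\<in>B. \<Sum>m\<in>B. \<Sum>k\<in>B. lam (S (coef m k)) (coef l m) * \<gamma> (coef k l))"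
proof -
  let ?b = "\<lambda>t1 t2 t3. lam (S t1) t3 * \<gamma> t2"
  have b: "bilinear_map sC sC (*) (?b x)" for x
    by (intro bilinear_mapI vs vector_space_mult) (simp_all add: algebra_simps)
  have b1: "?b (x + x') y z = ?b x y z + ?b x' y z" "?b (sC a x) y z = a * ?b x y z" for a x x' y z
    by (simp_all add: S.add S.scale algebra_simps)
  have "Vector_Spaces.linear sC (*) (\<lambda>c. sweedler3 sC \<Delta> ?b c)"
    unfolding sweedler3_def by (rule linear_sweedler2[OF bilinear_sweedler2[of "(*)" ?b, OF b b1]])
  then interpret L: Vector_Spaces.linear sC "(*)" "sweedler3 sC \<Delta> ?b" .
  have "sweedler3 sC \<Delta> ?b (character sC sV \<rho> B) =
      (\<Sum>m\<in>B. \<Sum>k\<in>B. \<Sum>l\<in>B. lam (S (coef m k)) (coef l m) * \<gamma> (coef k l))"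
    by (simp add: character_def L.sum sweedler3_coef[of "(*)" ?b, OF b b1])
  also have "\<dots> = (\<Sum>m\<in>B. \<Sum>l\<in>B. \<Sum>k\<in>B. lam (S (coef m k)) (coef l m) * \<gamma> (coef k l))"
    by (rule sum.cong[OF refl], rule sum.swap)
  also have "\<dots> = (\<Sum>l\<in>B. \<Sum>m\<in>B. \<Sum>k\<in>B. lam (S (coef m k)) (coef l m) * \<gamma> (coef k l))"
    by (rule sum.swap)
  finally show ?thesis .
qed

text \<open>Here \<open>t1\<close> is \<open>coef m l\<close> and \<open>t2\<close> is
  \<open>coef l m\<close>; the action of \<gamma> splits \<open>t1\<close> further and contributes
  the sum over \<open>k\<close>.\<close>

lemma sweedler2_character:
  "sweedler2 sC \<Delta> (\<lambda>t1 t2. lam (S (dual_action sC sC \<Delta> \<gamma> t1)) t2) (character sC sV \<rho> B) =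
    (\<Sum>l\<in>B. \<Sum>m\<in>B. \<Sum>k\<in>B. lam (S (coef m k)) (coef l m) * \<gamma> (coef k l))"
proof -
  let ?a = "dual_action sC sC \<Delta> \<gamma>"
  let ?b = "\<lambda>t1 t2. lam (S (?a t1)) t2"
  have g: "bilinear_map sC sC sC (\<lambda>x c. sC (\<gamma> c) x)"
    by (intro bilinear_mapI vs) (simp_all add: scale_left_distrib scale_right_distrib mult.commute)
  have a: "Vector_Spaces.linear sC sC ?a"
    using linear_sweedler2[OF g] unfolding dual_action_def[abs_def] sweedler2_def[abs_def] .
  have a_coef: "?a (coef i j) = (\<Sum>k\<in>B. sC (\<gamma> (coef k j)) (coef i k))" if "i \<in> B" for i j
    using sweedler2_coef[OF g that] by (simp add: dual_action_def sweedler2_def)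
  have b: "bilinear_map sC sC (*) ?b"
    using a unfolding Vector_Spaces.linear_iff
    by (intro bilinear_mapI vs vector_space_mult) (simp_all add: S.add S.scale)
  interpret L: Vector_Spaces.linear sC "(*)" "sweedler2 sC \<Delta> ?b"
    by (rule linear_sweedler2[OF b])
  have "sweedler2 sC \<Delta> ?b (character sC sV \<rho> B) =
      (\<Sum>m\<in>B. \<Sum>l\<in>B. \<Sum>k\<in>B. lam (S (coef m k)) (coef l m) * \<gamma> (coef k l))"
    by (simp add: character_def L.sum sweedler2_coef[OF b] a_coef S.sum S.scale lam_sum_left mult.commute)
  also have "\<dots> = (\<Sum>l\<in>B. \<Sum>m\<in>B. \<Sum>k\<in>B. lam (S (coef m k)) (coef l m) * \<gamma> (coef k l))"
    by (rule sum.swap)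
  finally show ?thesis .
qed

end

theorem theorem4p7:
  fixes sC :: "'k::field \<Rightarrow> 'c::ab_group_add \<Rightarrow> 'c"
    and \<Delta> :: "'c \<Rightarrow> ('c \<Rightarrow> 'c \<Rightarrow> 'k) \<Rightarrow> 'k"
    and \<epsilon> :: "'c \<Rightarrow> 'k"
    and S :: "'c \<Rightarrow> 'c"
    and \<gamma> \<gamma>bar :: "'c \<Rightarrow> 'k"
    and lam :: "'c \<Rightarrow> 'c \<Rightarrow> 'k"
    and sV :: "'k \<Rightarrow> 'v::ab_group_add \<Rightarrow> 'v"
    and \<rho> :: "'v \<Rightarrow> ('v \<Rightarrow> 'c \<Rightarrow> 'k) \<Rightarrow> 'k"
    and B :: "'v set"
  assumes char_k: "CHAR('k) \<noteq> 2"
    and copivotal: "copivotal_coalgebra sC \<Delta> \<epsilon> S \<gamma> \<gamma>bar"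
    and coseparable: "coseparability_idempotent sC \<Delta> \<epsilon> lam"
    and comodule: "right_comodule sC \<Delta> \<epsilon> sV \<rho>"
    and basis: "finite_dimensional_vector_space sV B"
  shows "fs_indicator sC S \<gamma> sV \<rho>
           = sweedler2 sC \<Delta> (\<lambda>t1 t2. lam (S (dual_action sC sC \<Delta> \<gamma> t1)) t2)
               (character sC sV \<rho> B)
       \<and> fs_indicator sC S \<gamma> sV \<rho>
           = sweedler3 sC \<Delta> (\<lambda>t1 t2 t3. lam (S t1) t3 * \<gamma> t2) (character sC sV \<rho> B)"
proof -
  interpret copivotal_coalgebra sC \<Delta> \<epsilon> S \<gamma> \<gamma>bar by (rule copivotal)
  interpret right_comodule sC \<Delta> \<epsilon> sV \<rho> by (rule comodule)
  interpret F: finite_dimensional_vector_space sV B by (rule basis)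
  interpret coseparable_copivotal_comodule sC \<Delta> \<epsilon> S \<gamma> \<gamma>bar sV \<rho> B lam
    using F.finite_Basis F.independent_Basis F.span_Basis coseparable by unfold_locales
  \<comment> \<open>The indicator and both Sweedler expressions equal one and the same triple sum
    over \<open>B\<close>.\<close>
  show ?thesis
    by (simp only: fs_indicator_eq_sum sweedler2_character sweedler3_character)
qed

end
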